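(* Let $R$ be a commutative noetherian Cohen--Macaulay local ring of dimension one with maximal ideal $\mathfrak{m}$ and infinite residue field $k$. Suppose that the associated graded ring $\mathrm{gr}_{\mathfrak m}R=\bigoplus_{i\ge0}\mathfrak{m}^i/\mathfrak{m}^{i+1}$ has positive depth (or equivalently, that $\mathrm{gr}_{\mathfrak m}R$ is a Cohen--Macaulay ring). Let $n$ be a positive integer. Then every $R$-module of finite length can be built out of $R/\mathfrak{m}^n$ by taking direct summands and extensions.
   Context: Let $\mathrm{mod}\,R$ be the category of finitely generated $R$-modules. An $R$-module $N$ "can be built out of $M$ by taking direct summands and extensions" if $N$ belongs to $\mathrm{ext}_R M$, the smallest strictly full subcategory of $\mathrm{mod}\,R$ that contains $M$ and is closed under direct summands and under extensions (if $0\to L\to E\to N\to0$ is exact with $L,N$ in the subcategory, then so is $E$). The depth of $\mathrm{gr}_{\mathfrak m}R$ is taken with respect to its homogeneous maximal ideal. *)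

theory Defs
  imports "HOL-Algebra.Module" "HOL-Algebra.Ideal_Product" "HOL-Algebra.Ring_Divisibility"
    "HOL-Library.Extended_Nat"
begin

section \<open>Local rings, dimension and depth\<close>

definition local_ring :: "('a, 'r) ring_scheme \<Rightarrow> 'a set \<Rightarrow> bool" where
  "local_ring R \<mm> \<longleftrightarrow> cring R \<and> maximalideal \<mm> R \<and> (\<forall>I. maximalideal I R \<longrightarrow> I = \<mm>)"

definition krull_dim :: "('a, 'r) ring_scheme \<Rightarrow> enat" where
  "krull_dim R = Sup {enat l | l. \<exists>P :: nat \<Rightarrow> 'a set.
     (\<forall>i\<le>l. primeideal (P i) R) \<and> (\<forall>i<l. P i \<subset> P (Suc i))}"

text \<open>The second conjunct says that \<open>xs ! i\<close> is a nonzerodivisor on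
  \<open>R/(x\<^sub>0, \<dots>, x\<^sub>i\<^sub>-\<^sub>1)\<close>, the third that \<open>R/(xs)\<close> is nonzero.\<close>

definition regular_sequence :: "('a, 'r) ring_scheme \<Rightarrow> 'a list \<Rightarrow> bool" where
  "regular_sequence R xs \<longleftrightarrow>
     set xs \<subseteq> carrier R \<and>
     (\<forall>i<length xs. \<forall>r\<in>carrier R.
        xs ! i \<otimes>\<^bsub>R\<^esub> r \<in> Idl\<^bsub>R\<^esub> (set (take i xs)) \<longrightarrow> r \<in> Idl\<^bsub>R\<^esub> (set (take i xs))) \<and>
     Idl\<^bsub>R\<^esub> (set xs) \<noteq> carrier R"

definition depth :: "('a, 'r) ring_scheme \<Rightarrow> 'a set \<Rightarrow> enat" where
  "depth R I = Sup {enat (length xs) | xs. set xs \<subseteq> I \<and> regular_sequence R xs}"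

definition cohen_macaulay_local :: "('a, 'r) ring_scheme \<Rightarrow> 'a set \<Rightarrow> bool" where
  "cohen_macaulay_local R \<mm> \<longleftrightarrow>
     noetherian_ring R \<and> local_ring R \<mm> \<and> depth R \<mm> = krull_dim R"


section \<open>The associated graded ring\<close>

definition ideal_power :: "('a, 'r) ring_scheme \<Rightarrow> 'a set \<Rightarrow> nat \<Rightarrow> 'a set" where
  "ideal_power R I n = I [^]\<^bsub>ideals_set R\<^esub> n"

text \<open>An element of \<open>gr\<^sub>I R\<close> is the sequence of its homogeneous components; the component of
  degree \<open>i\<close> is a coset of \<open>I\<^sup>i\<^sup>+\<^sup>1\<close> with a representative in \<open>I\<^sup>i\<close>. For components \<open>f i\<close> and
  \<open>g j\<close> with \<open>i + j = n\<close>, all products of representatives lie in one coset of \<open>I\<^sup>n\<^sup>+\<^sup>1\<close>, and this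
  coset is \<^term>\<open>rcoset_mult R (ideal_power R I (Suc n)) (f i) (g j)\<close>.\<close>

definition assoc_graded :: "('a, 'r) ring_scheme \<Rightarrow> 'a set \<Rightarrow> (nat \<Rightarrow> 'a set) ring" where
  "assoc_graded R I =
     \<lparr>carrier = {f. (\<forall>i. \<exists>x\<in>ideal_power R I i. f i = ideal_power R I (Suc i) +>\<^bsub>R\<^esub> x) \<and>
                    finite {i. f i \<noteq> ideal_power R I (Suc i)}},
      monoid.mult = (\<lambda>f g n. finsum (R Quot ideal_power R I (Suc n))
                (\<lambda>i. rcoset_mult R (ideal_power R I (Suc n)) (f i) (g (n - i))) {..n}),
      one = (\<lambda>i. if i = 0 then ideal_power R I 1 +>\<^bsub>R\<^esub> \<one>\<^bsub>R\<^esub> else ideal_power R I (Suc i)),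
      ring.zero = (\<lambda>i. ideal_power R I (Suc i)),
      add = (\<lambda>f g i. f i <+>\<^bsub>R\<^esub> g i)\<rparr>"

text \<open>The ideal of elements with vanishing component in degree zero. If \<open>I\<close> is maximal, the
  degree zero part \<open>R/I\<close> is a field, and this is the homogeneous maximal ideal.\<close>

definition irrelevant_ideal :: "('a, 'r) ring_scheme \<Rightarrow> 'a set \<Rightarrow> (nat \<Rightarrow> 'a set) set" where
  "irrelevant_ideal R I = {f \<in> carrier (assoc_graded R I). f 0 = \<zero>\<^bsub>assoc_graded R I\<^esub> 0}"


section \<open>Modules\<close>

text \<open>The record \<^typ>\<open>('a, 'b) module\<close> extends the ring record; its fields \<open>mult\<close> and
  \<open>one\<close> carry no meaning for a module and are ignored by homomorphisms.\<close>

definition module_hom ::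
  "('a, 'r) ring_scheme \<Rightarrow> ('a, 'b, 'm) module_scheme \<Rightarrow> ('a, 'c, 'n) module_scheme \<Rightarrow> ('b \<Rightarrow> 'c) set"
  where
  "module_hom R M N = {h. h \<in> carrier M \<rightarrow> carrier N \<and>
     (\<forall>x\<in>carrier M. \<forall>y\<in>carrier M. h (x \<oplus>\<^bsub>M\<^esub> y) = h x \<oplus>\<^bsub>N\<^esub> h y) \<and>
     (\<forall>a\<in>carrier R. \<forall>x\<in>carrier M. h (a \<odot>\<^bsub>M\<^esub> x) = a \<odot>\<^bsub>N\<^esub> h x)}"

definition module_iso ::
  "('a, 'r) ring_scheme \<Rightarrow> ('a, 'b, 'm) module_scheme \<Rightarrow> ('a, 'c, 'n) module_scheme \<Rightarrow> bool" where
  "module_iso R M N \<longleftrightarrow> (\<exists>h\<in>module_hom R M N. bij_betw h (carrier M) (carrier N))"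

definition short_exact ::
  "('a, 'r) ring_scheme \<Rightarrow> ('a, 'b, 'm) module_scheme \<Rightarrow> ('a, 'c, 'n) module_scheme
     \<Rightarrow> ('a, 'd, 'p) module_scheme \<Rightarrow> ('b \<Rightarrow> 'c) \<Rightarrow> ('c \<Rightarrow> 'd) \<Rightarrow> bool" where
  "short_exact R L E N f g \<longleftrightarrow>
     f \<in> module_hom R L E \<and> g \<in> module_hom R E N \<and>
     inj_on f (carrier L) \<and> f ` carrier L = {x \<in> carrier E. g x = \<zero>\<^bsub>N\<^esub>} \<and>
     g ` carrier E = carrier N"

definition direct_sum ::
  "('a, 'b, 'm) module_scheme \<Rightarrow> ('a, 'c, 'n) module_scheme \<Rightarrow> ('a, 'b \<times> 'c) module" where
  "direct_sum M N =
     \<lparr>carrier = carrier M \<times> carrier N, monoid.mult = undefined, one = undefined,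
      ring.zero = (\<zero>\<^bsub>M\<^esub>, \<zero>\<^bsub>N\<^esub>),
      add = (\<lambda>(x, y) (x', y'). (x \<oplus>\<^bsub>M\<^esub> x', y \<oplus>\<^bsub>N\<^esub> y')),
      smult = (\<lambda>a (x, y). (a \<odot>\<^bsub>M\<^esub> x, a \<odot>\<^bsub>N\<^esub> y))\<rparr>"

definition quotient_module :: "('a, 'r) ring_scheme \<Rightarrow> 'a set \<Rightarrow> ('a, 'a set) module" where
  "quotient_module R I =
     ring.extend (R Quot I) (module.fields (\<lambda>a X. (I +>\<^bsub>R\<^esub> a) \<otimes>\<^bsub>R Quot I\<^esub> X))"

definition fin_gen_module :: "('a, 'r) ring_scheme \<Rightarrow> ('a, 'b, 'm) module_scheme \<Rightarrow> bool" where
  "fin_gen_module R M \<longleftrightarrow> module R M \<and>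
     (\<exists>S. finite S \<and> S \<subseteq> carrier M \<and> (\<forall>H. submodule H R M \<and> S \<subseteq> H \<longrightarrow> H = carrier M))"

text \<open>Finite length: the existence of a composition series.\<close>

definition finite_length :: "('a, 'r) ring_scheme \<Rightarrow> ('a, 'b, 'm) module_scheme \<Rightarrow> bool" where
  "finite_length R M \<longleftrightarrow> module R M \<and>
     (\<exists>(l :: nat) (H :: nat \<Rightarrow> 'b set).
        H 0 = {\<zero>\<^bsub>M\<^esub>} \<and> H l = carrier M \<and> (\<forall>i\<le>l. submodule (H i) R M) \<and>
        (\<forall>i<l. H i \<subset> H (Suc i) \<and>
           (\<forall>K. submodule K R M \<and> H i \<subseteq> K \<and> K \<subseteq> H (Suc i) \<longrightarrow> K = H i \<or> K = H (Suc i))))"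


section \<open>Building modules by direct summands and extensions\<close>

text \<open>HOL has no type of all modules, so \<open>mod R\<close> is represented by the finitely generated modules
  whose elements have type \<^typ>\<open>(nat \<Rightarrow> 'a) set\<close>. This loses nothing up to isomorphism: a finitely
  generated module is a quotient of some \<open>R\<^sup>n\<close>, and the cosets in \<open>R\<^sup>n\<close>, regarded as a set of
  sequences that vanish from \<open>n\<close> on, have this type.\<close>

type_synonym 'a fg_module = "('a, (nat \<Rightarrow> 'a) set) module"

definition mod_cat :: "('a, 'r) ring_scheme \<Rightarrow> 'a fg_module set" where
  "mod_cat R = {M. fin_gen_module R M}"

text \<open>Full subcategories are identified with their classes of objects.\<close>

definition strict_subcat :: "('a, 'r) ring_scheme \<Rightarrow> 'a fg_module set \<Rightarrow> bool" where
  "strict_subcat R \<X> \<longleftrightarrow> \<X> \<subseteq> mod_cat R \<and>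
     (\<forall>X\<in>\<X>. \<forall>Y\<in>mod_cat R. module_iso R X Y \<longrightarrow> Y \<in> \<X>)"

definition closed_summands :: "('a, 'r) ring_scheme \<Rightarrow> 'a fg_module set \<Rightarrow> bool" where
  "closed_summands R \<X> \<longleftrightarrow>
     (\<forall>X\<in>\<X>. \<forall>Y\<in>mod_cat R. \<forall>Z\<in>mod_cat R. module_iso R (direct_sum Y Z) X \<longrightarrow> Y \<in> \<X>)"

definition closed_extensions :: "('a, 'r) ring_scheme \<Rightarrow> 'a fg_module set \<Rightarrow> bool" where
  "closed_extensions R \<X> \<longleftrightarrow>
     (\<forall>L\<in>\<X>. \<forall>N\<in>\<X>. \<forall>E\<in>mod_cat R. (\<exists>f g. short_exact R L E N f g) \<longrightarrow> E \<in> \<X>)"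

text \<open>Since \<open>M\<close> may have elements of any type, containing \<open>M\<close> means containing the objects of
  \<^term>\<open>mod_cat R\<close> isomorphic to \<open>M\<close>.\<close>

definition ext_cat :: "('a, 'r) ring_scheme \<Rightarrow> ('a, 'b, 'm) module_scheme \<Rightarrow> 'a fg_module set" where
  "ext_cat R M = \<Inter>{\<X>. strict_subcat R \<X> \<and> closed_summands R \<X> \<and> closed_extensions R \<X> \<and>
                        {X \<in> mod_cat R. module_iso R X M} \<subseteq> \<X>}"

definition built_from ::
  "('a, 'r) ring_scheme \<Rightarrow> ('a, 'b, 'm) module_scheme \<Rightarrow> ('a, 'c, 'n) module_scheme \<Rightarrow> bool" where
  "built_from R M N \<longleftrightarrow> (\<exists>X\<in>ext_cat R M. module_iso R X N)"

end

theory Submission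
  imports Defs "HOL-Algebra.UnivPoly" "HOL-Algebra.Subrings"
begin

text \<open>Suppose \<open>x \<in> \<mm>\<close> acts injectively \<open>\<mm>\<^sup>j/\<mm>\<^sup>j\<^sup>+\<^sup>1 \<rightarrow> \<mm>\<^sup>j\<^sup>+\<^sup>1/\<mm>\<^sup>j\<^sup>+\<^sup>2\<close>, and let \<open>K/\<mm>\<^sup>j\<^sup>+\<^sup>2\<close> be a complement
  of the image. Then \<open>s \<mapsto> (s, xs)\<close> and \<open>(t, r) \<mapsto> r - xt\<close> give an exact sequence
  \<open>0 \<rightarrow> R/\<mm>\<^sup>j\<^sup>+\<^sup>1 \<rightarrow> R/\<mm>\<^sup>j \<oplus> R/K \<rightarrow> R/\<mm>\<^sup>j\<^sup>+\<^sup>1 \<rightarrow> 0\<close>, so \<open>R/\<mm>\<^sup>j\<close> is built out of \<open>R/\<mm>\<^sup>j\<^sup>+\<^sup>1\<close>. Descending from \<open>n\<close> one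
  reaches the residue field, and a composition series does the rest.

  If no such \<open>x\<close> exists for some \<open>j\<close>, every point of the curve \<open>\<lambda> \<mapsto> \<Sum>\<^sub>i \<lambda>\<^sup>i x\<^sub>i\<close> in \<open>\<mm>\<close>, where the \<open>x\<^sub>i\<close>
  generate \<open>\<mm>\<close>, kills a nonzero form of degree \<open>j\<close>. As the residue field is infinite, these forms
  can be combined by noetherianity, and McCoy's argument yields one nonzero form killed by all of
  \<open>\<mm>/\<mm>\<^sup>2\<close>, contradicting positive depth. This bounds the degrees involved and needs no associated
  primes of the graded ring.\<close>

subsection \<open>Powers of an ideal\<close>

text \<open>The annihilated forms differ from point to point of the curve, so they are not the
  values of one polynomial to which McCoy's theorem could be applied. They are kept as a tuple
  \<open>u\<close> indexed by the parameters \<open>l i\<close>, and the moments, the sums of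
  \<open>l i [^] s \<otimes> u i\<close> over \<open>i\<close>, replace coefficients: the relations
  at the single points become a linear recurrence for the moments with coefficients
  \<open>xs\<close>, and since differences of parameters are units, the moments determine the tuple
  (Vandermonde). The recurrence needs a start with vanishing moments; producing it is the purpose of
  the noetherian dependency. Throughout, a form of degree \<open>j\<close> is represented by an
  element of \<open>ideal_power R I j\<close>, and it is zero if this element lies in
  \<open>ideal_power R I (Suc j)\<close>. The graded ring itself is entered only to extract from its
  depth that no nonzero form is killed by all of \<open>I\<close>.\<close>

context cring
begin

lemma ideal_power_0 [simp]: "ideal_power R I 0 = carrier R"
  by (simp add: ideal_power_def ideals_set_def)

lemma ideal_power_Suc: "ideal_power R I (Suc n) = ideal_power R I n \<cdot> I"
  by (simp add: ideal_power_def ideals_set_def)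

lemma ideal_power_ideal: "ideal I R \<Longrightarrow> ideal (ideal_power R I n) R"
  by (induction n) (simp_all add: oneideal ideal_power_Suc ideal_prod_is_ideal)

lemma ideal_power_1:
  assumes "ideal I R" shows "ideal_power R I (Suc 0) = I"
  using assms ideal_prod_commute[OF oneideal assms] by (simp add: ideal_power_Suc ideal_prod_one)

lemma ideal_power_carrier: "ideal I R \<Longrightarrow> a \<in> ideal_power R I n \<Longrightarrow> a \<in> carrier R"
  using ideal.Icarr[OF ideal_power_ideal] .

lemma ideal_prod_subsetI:
  assumes "ideal K R" and "\<And>a b. a \<in> I \<Longrightarrow> b \<in> J \<Longrightarrow> a \<otimes> b \<in> K"
  shows "I \<cdot> J \<subseteq> K"
proof
  fix x assume "x \<in> I \<cdot> J"
  then show "x \<in> K"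
    by induction (auto intro: assms additive_subgroup.a_closed[OF ideal.axioms(1)[OF assms(1)]])
qed

lemma ideal_power_add:
  assumes "ideal I R"
  shows "ideal_power R I (i + j) = ideal_power R I i \<cdot> ideal_power R I j"
proof (induction j)
  case 0
  then show ?case using assms by (simp add: ideal_prod_one ideal_power_ideal)
next
  case (Suc j)
  then show ?case
    using assms by (simp add: ideal_power_Suc ideal_prod_assoc ideal_power_ideal)
qed

lemma ideal_power_mult:
  assumes "ideal I R" "a \<in> ideal_power R I i" "b \<in> ideal_power R I j" "i + j = k"
  shows "a \<otimes> b \<in> ideal_power R I k"
  using assms ideal_power_add[OF assms(1), of i j] by (auto intro: ideal_prod.prod)

lemma ideal_power_antimono:
  assumes "ideal I R" "i \<le> j"
  shows "ideal_power R I j \<subseteq> ideal_power R I i"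
  using assms ideal_power_add[OF assms(1), of i "j - i"]
    ideal_prod_inter[OF ideal_power_ideal ideal_power_ideal, OF assms(1) assms(1)] by force

lemma ideal_power_mult1:
  assumes "ideal I R" "a \<in> I" "b \<in> ideal_power R I j"
  shows "a \<otimes> b \<in> ideal_power R I (Suc j)"
  using ideal_power_mult[OF assms(1) _ assms(3), of a 1 "Suc j"] assms(2) ideal_power_1[OF assms(1)]
  by simp

lemma ideal_nat_pow_mem:
  assumes "ideal I R" "a \<in> I"
  shows "a [^] k \<in> ideal_power R I k"
  using assms by (induction k) (simp_all add: ideal_power_Suc ideal_prod.prod)

lemma ideal_add_mem: "ideal I R \<Longrightarrow> a \<in> I \<Longrightarrow> b \<in> I \<Longrightarrow> a \<oplus> b \<in> I"
  by (rule additive_subgroup.a_closed[OF ideal.axioms(1)])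

lemma ideal_zero_mem: "ideal I R \<Longrightarrow> \<zero> \<in> I"
  by (rule additive_subgroup.zero_closed[OF ideal.axioms(1)])

lemma ideal_neg_mem: "ideal I R \<Longrightarrow> a \<in> I \<Longrightarrow> \<ominus> a \<in> I"
  by (rule additive_subgroup.a_inv_closed[OF ideal.axioms(1)])

lemma ideal_minus_mem: "ideal I R \<Longrightarrow> a \<in> I \<Longrightarrow> b \<in> I \<Longrightarrow> a \<ominus> b \<in> I"
  unfolding a_minus_def by (intro ideal_add_mem ideal_neg_mem)

lemma ideal_finsum_mem:
  assumes "ideal I R" "finite A" "\<And>i. i \<in> A \<Longrightarrow> f i \<in> I"
  shows "(\<Oplus>i\<in>A. f i) \<in> I"
  using assms(2,3)
proof (induction A)
  case empty
  then show ?case by (simp add: ideal_zero_mem[OF assms(1)])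
next
  case (insert x A)
  moreover have "f \<in> A \<rightarrow> carrier R" "f x \<in> carrier R"
    using insert.prems ideal.Icarr[OF assms(1)] by auto
  ultimately show ?case by (simp add: finsum_insert ideal_add_mem[OF assms(1)])
qed

lemma finsum_combination:
  assumes "\<And>i. f i \<in> carrier R" "\<And>i. g i \<in> carrier R" "c \<in> carrier R"
  shows "(\<Oplus>i\<in>{..<N::nat}. c \<otimes> f i \<oplus> g i) = c \<otimes> (\<Oplus>i\<in>{..<N}. f i) \<oplus> (\<Oplus>i\<in>{..<N}. g i)"
proof -
  have "(\<Oplus>i\<in>{..<N}. c \<otimes> f i \<oplus> g i) = (\<Oplus>i\<in>{..<N}. c \<otimes> f i) \<oplus> (\<Oplus>i\<in>{..<N}. g i)"
    using assms by (intro finsum_addf) auto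
  moreover have "c \<otimes> (\<Oplus>i\<in>{..<N}. f i) = (\<Oplus>i\<in>{..<N}. c \<otimes> f i)"
    using assms by (intro finsum_rdistr) auto
  ultimately show ?thesis by simp
qed

lemma ideal_Units_cancel:
  assumes "ideal I R" "c \<in> Units R" "a \<in> carrier R" "c \<otimes> a \<in> I"
  shows "a \<in> I"
proof -
  have "inv c \<otimes> (c \<otimes> a) \<in> I"
    by (rule ideal.I_l_closed[OF assms(1,4)]) (use assms(2) in simp)
  moreover have "inv c \<otimes> (c \<otimes> a) = a"
    using assms m_assoc[of "inv c" c a] Units_closed[OF assms(2)] by simp
  ultimately show ?thesis by simp
qed

text \<open>This lets a property checked on generators, or on products of elements, pass to the
  ideal they generate.\<close>

lemma ideal_colon:
  assumes "ideal I R" "w \<in> carrier R"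
  shows "ideal {a \<in> carrier R. a \<otimes> w \<in> I} R"
proof (rule idealI[OF ring_axioms])
  show "subgroup {a \<in> carrier R. a \<otimes> w \<in> I} (add_monoid R)"
    using assms
    by (intro add.subgroupI)
      (auto simp: l_distr l_minus ideal_zero_mem ideal_add_mem ideal_neg_mem intro: exI[of _ \<zero>])
next
  fix a x assume "a \<in> {a \<in> carrier R. a \<otimes> w \<in> I}" "x \<in> carrier R"
  with assms show "x \<otimes> a \<in> {a \<in> carrier R. a \<otimes> w \<in> I}"
    by (simp add: m_assoc ideal.I_l_closed)
  then show "a \<otimes> x \<in> {a \<in> carrier R. a \<otimes> w \<in> I}"
    using \<open>a \<in> _\<close> \<open>x \<in> _\<close> by (simp add: m_comm)
qed


subsection \<open>Common annihilators of a pencil\<close>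

text \<open>Elimination instead of a determinant: passing from \<open>u i\<close> to
  \<open>(l i \<ominus> l N) \<otimes> u i\<close> removes the last entry, and the new moment of
  exponent \<open>s\<close> is the old one of exponent \<open>Suc s\<close> minus \<open>l N\<close>
  times the old one of exponent \<open>s\<close>. The unit factors are cancelled afterwards, and the
  moment of exponent 0 recovers the last entry.\<close>

lemma vandermonde_mem:
  fixes N :: nat
  assumes "ideal J R"
    and "\<And>i. l i \<in> carrier R" "\<And>i. u i \<in> carrier R"
    and "\<And>i k. i < N \<Longrightarrow> k < N \<Longrightarrow> i \<noteq> k \<Longrightarrow> l i \<ominus> l k \<in> Units R"
    and "\<And>s. s < N \<Longrightarrow> (\<Oplus>i\<in>{..<N}. l i [^] s \<otimes> u i) \<in> J"
    and "k < N"
  shows "u k \<in> J"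
  using assms(3-)
proof (induction N arbitrary: u k)
  case 0
  then show ?case by simp
next
  case (Suc N)
  note lc = assms(2) and uc = Suc.prems(1)
  have mem: "u k \<in> J" if "k < N" for k
  proof -
    have "(l k \<ominus> l N) \<otimes> u k \<in> J"
    proof (rule Suc.IH[of "\<lambda>i. (l i \<ominus> l N) \<otimes> u i" k])
      show "(l i \<ominus> l N) \<otimes> u i \<in> carrier R" for i
        using lc uc by simp
      show "l i \<ominus> l k \<in> Units R" if "i < N" "k < N" "i \<noteq> k" for i k
        using Suc.prems(2) that by simp
      show "(\<Oplus>i\<in>{..<N}. l i [^] s \<otimes> ((l i \<ominus> l N) \<otimes> u i)) \<in> J" if "s < N" for s
      proof -
        define A where "A = (\<Oplus>i\<in>{..<N}. l i [^] s \<otimes> u i)"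
        define B where "B = (\<Oplus>i\<in>{..<N}. l i [^] Suc s \<otimes> u i)"
        have AB: "A \<in> carrier R" "B \<in> carrier R"
          unfolding A_def B_def using lc uc by (auto intro!: finsum_closed)
        have "(\<Oplus>i\<in>{..<N}. l i [^] s \<otimes> ((l i \<ominus> l N) \<otimes> u i)) =
              (\<Oplus>i\<in>{..<N}. (\<ominus> l N) \<otimes> (l i [^] s \<otimes> u i) \<oplus> l i [^] Suc s \<otimes> u i)"
        proof (rule finsum_cong')
          fix i
          have "l i \<in> carrier R" "u i \<in> carrier R" "l N \<in> carrier R" "l i [^] s \<in> carrier R"
            using lc uc by auto
          then show "l i [^] s \<otimes> ((l i \<ominus> l N) \<otimes> u i) =
              (\<ominus> l N) \<otimes> (l i [^] s \<otimes> u i) \<oplus> l i [^] Suc s \<otimes> u i"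
            unfolding nat_pow_Suc by algebra
        qed (use lc uc in auto)
        also have "\<dots> = (\<ominus> l N) \<otimes> A \<oplus> B"
          unfolding A_def B_def using lc uc by (intro finsum_combination) auto
        \<comment> \<open>The entry of index \<open>N\<close> enters twice and cancels; with it both
          brackets are full moments over \<open>{..<Suc N}\<close>, to which the hypothesis
          applies.\<close>
        also have "\<dots> = (l N [^] Suc s \<otimes> u N \<oplus> B) \<ominus> l N \<otimes> (l N [^] s \<otimes> u N \<oplus> A)"
        proof -
          have "l N \<in> carrier R" "u N \<in> carrier R" "l N [^] s \<in> carrier R"
            using lc uc by auto
          then show ?thesis unfolding nat_pow_Suc using AB by algebra
        qed
        also have "\<dots> \<in> J"
        proof -
          have "l N [^] s \<otimes> u N \<oplus> A \<in> J" "l N [^] Suc s \<otimes> u N \<oplus> B \<in> J"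
            unfolding A_def B_def
            using Suc.prems(3)[of s] Suc.prems(3)[of "Suc s"] that lc uc
            by (auto simp: lessThan_Suc finsum_insert Pi_def simp del: nat_pow_Suc)
          then show ?thesis
            using assms(1) lc by (intro ideal_minus_mem ideal.I_l_closed)
        qed
        finally show ?thesis .
      qed
    qed (use that in auto)
    moreover have "l k \<ominus> l N \<in> Units R"
      using Suc.prems(2) that by simp
    ultimately show ?thesis
      using ideal_Units_cancel[OF assms(1)] uc by blast
  qed
  moreover have "u N \<in> J"
  proof -
    define A where "A = (\<Oplus>i\<in>{..<N}. u i)"
    have "A \<in> J" unfolding A_def using mem by (intro ideal_finsum_mem assms(1)) auto
    moreover have "u N \<oplus> A \<in> J"
      using Suc.prems(3)[of 0] lc uc by (simp add: lessThan_Suc finsum_insert Pi_def A_def)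
    ultimately have "(u N \<oplus> A) \<ominus> A \<in> J" by (intro ideal_minus_mem assms(1))
    moreover have "(u N \<oplus> A) \<ominus> A = u N"
      using uc[of N] ideal.Icarr[OF assms(1) \<open>A \<in> J\<close>] by algebra
    ultimately show ?thesis by simp
  qed
  ultimately show ?case using Suc.prems(4) less_Suc_eq by blast
qed

text \<open>A point of the curve in the ideal generated by the list. The head is the leading
  coefficient, so that removing it, as McCoy's argument does, leaves the pencil of the tail.\<close>

primrec pencil :: "'a list \<Rightarrow> 'a \<Rightarrow> 'a" where
  "pencil [] x = \<zero>"
| "pencil (a # ys) x = a \<otimes> x [^] length ys \<oplus> pencil ys x"

lemma pencil_closed: "set ys \<subseteq> carrier R \<Longrightarrow> x \<in> carrier R \<Longrightarrow> pencil ys x \<in> carrier R"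
  by (induction ys) auto

declare pencil.simps(2) [simp del]

text \<open>Expanding the pencil gives a combination of the moments of exponents \<open>e\<close> to
  \<open>e + length ys - 1\<close> with coefficients in \<open>ys\<close>, and each coefficient
  raises the degree by one. The factor \<open>r\<close> will be a power of the leading
  coefficient.\<close>

lemma pencil_moments_mem:
  fixes N :: nat
  assumes I: "ideal I R" and l: "\<And>i. l i \<in> carrier R" and u: "\<And>i. u i \<in> carrier R"
    and r: "r \<in> carrier R" and ys: "set ys \<subseteq> I"
    and "\<And>s. s < e + length ys \<Longrightarrow> r \<otimes> (\<Oplus>i\<in>{..<N}. l i [^] s \<otimes> u i) \<in> ideal_power R I k"
  shows "r \<otimes> (\<Oplus>i\<in>{..<N}. l i [^] e \<otimes> (pencil ys (l i) \<otimes> u i)) \<in> ideal_power R I (Suc k)"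
  using ys assms(6)
proof (induction ys)
  case Nil
  then show ?case
    using l u r ideal_zero_mem[OF ideal_power_ideal[OF I]] by simp
next
  case (Cons y ys)
  have y: "y \<in> carrier R" "y \<in> I" and ys: "set ys \<subseteq> carrier R"
    using Cons.prems(1) ideal.Icarr[OF I] by auto
  note evc = pencil_closed[OF ys l]
  define A where "A = (\<Oplus>i\<in>{..<N}. l i [^] (e + length ys) \<otimes> u i)"
  define B where "B = (\<Oplus>i\<in>{..<N}. l i [^] e \<otimes> (pencil ys (l i) \<otimes> u i))"
  have AB: "A \<in> carrier R" "B \<in> carrier R"
    unfolding A_def B_def using l u evc by (auto intro!: finsum_closed)
  have "(\<Oplus>i\<in>{..<N}. l i [^] e \<otimes> (pencil (y # ys) (l i) \<otimes> u i)) =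
        (\<Oplus>i\<in>{..<N}. y \<otimes> (l i [^] (e + length ys) \<otimes> u i) \<oplus> l i [^] e \<otimes> (pencil ys (l i) \<otimes> u i))"
  proof (rule finsum_cong')
    fix i
    have "l i \<in> carrier R" "u i \<in> carrier R" "pencil ys (l i) \<in> carrier R"
      "l i [^] e \<in> carrier R" "l i [^] length ys \<in> carrier R" using l u evc by auto
    then show "l i [^] e \<otimes> (pencil (y # ys) (l i) \<otimes> u i) =
        y \<otimes> (l i [^] (e + length ys) \<otimes> u i) \<oplus> l i [^] e \<otimes> (pencil ys (l i) \<otimes> u i)"
      unfolding pencil.simps(2) nat_pow_mult[OF l, symmetric] using y(1) by algebra
  qed (use l u evc y in auto)
  also have "\<dots> = y \<otimes> A \<oplus> B"
    unfolding A_def B_def using l u evc y by (intro finsum_combination) auto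
  finally have eq: "r \<otimes> (\<Oplus>i\<in>{..<N}. l i [^] e \<otimes> (pencil (y # ys) (l i) \<otimes> u i)) =
      y \<otimes> (r \<otimes> A) \<oplus> r \<otimes> B"
    using r y AB by (simp add: r_distr m_lcomm)
  show ?case
    unfolding eq
  proof (intro ideal_add_mem ideal_power_ideal I)
    have "r \<otimes> A \<in> ideal_power R I k"
      unfolding A_def by (rule Cons.prems) simp
    then show "y \<otimes> (r \<otimes> A) \<in> ideal_power R I (Suc k)"
      by (rule ideal_power_mult1[OF I y(2)])
    show "r \<otimes> B \<in> ideal_power R I (Suc k)"
      unfolding B_def using Cons.prems by (intro Cons.IH) auto
  qed
qed

text \<open>McCoy's argument: the tuple \<open>u\<close> plays the role of a polynomial annihilated by
  the pencil, and the number of leading vanishing moments the role of its degree.\<close>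

lemma pencil_head_annihilator:
  fixes N :: nat
  assumes I: "ideal I R" and l: "\<And>i. l i \<in> carrier R"
    and diff: "\<And>i k. i < N \<Longrightarrow> k < N \<Longrightarrow> i \<noteq> k \<Longrightarrow> l i \<ominus> l k \<in> Units R"
    and u: "\<And>i. u i \<in> carrier R"
    and xs: "set (a # xs) \<subseteq> I"
    and ann: "\<And>i. i < N \<Longrightarrow> pencil (a # xs) (l i) \<otimes> u i \<in> ideal_power R I (Suc (Suc j))"
    and mom: "\<And>s. s < length xs \<Longrightarrow> (\<Oplus>i\<in>{..<N}. l i [^] s \<otimes> u i) \<in> ideal_power R I (Suc j)"
    and nz: "\<exists>i<N. u i \<notin> ideal_power R I (Suc j)"
  obtains e where "\<exists>i<N. a [^] e \<otimes> u i \<notin> ideal_power R I (Suc (j + e))"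
    and "\<And>i. i < N \<Longrightarrow> a \<otimes> (a [^] e \<otimes> u i) \<in> ideal_power R I (Suc (Suc (j + e)))"
proof -
  have a: "a \<in> I" "a \<in> carrier R" and xs': "set xs \<subseteq> carrier R" "set xs \<subseteq> I"
    using xs ideal.Icarr[OF I] by auto
  define v where "v s = (\<Oplus>i\<in>{..<N}. l i [^] s \<otimes> u i)" for s :: nat
  have v: "v s \<in> carrier R" for s
    unfolding v_def using l u by (auto intro!: finsum_closed)
  \<comment> \<open>The recurrence: weighting the relation at \<open>l i\<close> by
    \<open>l i [^] e\<close> and summing, \<open>a\<close> multiplies the moment of exponent
    \<open>e + length xs\<close>, and all other terms contain earlier moments, which
    \<open>a [^] e\<close> already kills. So each further factor \<open>a\<close> kills one more
    moment.\<close>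
  have lead: "a [^] e \<otimes> v s \<in> ideal_power R I (Suc (j + e))" if "s < e + length xs" for e s
    using that
  proof (induction e arbitrary: s)
    case 0
    then show ?case using mom v by (simp add: v_def)
  next
    case (Suc e)
    have step: "a [^] Suc e \<otimes> v s = a \<otimes> (a [^] e \<otimes> v s)" for s
      using a v by (simp add: m_ac)
    show ?case
    proof (cases "s < e + length xs")
      case True
      then show ?thesis
        using ideal_power_mult1[OF I a(1) Suc.IH[OF True]] step by simp
    next
      case False
      with Suc.prems have s: "s = e + length xs" by simp
      define B where "B = (\<Oplus>i\<in>{..<N}. l i [^] e \<otimes> (pencil xs (l i) \<otimes> u i))"
      have evc: "pencil xs (l i) \<in> carrier R" for i using pencil_closed[OF xs'(1) l] .
      have B: "B \<in> carrier R" unfolding B_def using l u evc by (auto intro!: finsum_closed)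
      have "(\<Oplus>i\<in>{..<N}. l i [^] e \<otimes> (pencil (a # xs) (l i) \<otimes> u i)) =
            (\<Oplus>i\<in>{..<N}. a \<otimes> (l i [^] s \<otimes> u i) \<oplus> l i [^] e \<otimes> (pencil xs (l i) \<otimes> u i))"
      proof (rule finsum_cong')
        fix i
        have "l i \<in> carrier R" "u i \<in> carrier R" "pencil xs (l i) \<in> carrier R"
          "l i [^] e \<in> carrier R" "l i [^] length xs \<in> carrier R" using l u evc by auto
        then show "l i [^] e \<otimes> (pencil (a # xs) (l i) \<otimes> u i) =
            a \<otimes> (l i [^] s \<otimes> u i) \<oplus> l i [^] e \<otimes> (pencil xs (l i) \<otimes> u i)"
          unfolding pencil.simps(2) s nat_pow_mult[OF l, symmetric] using a(2) by algebra
      qed (use l u evc a in auto)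
      also have "\<dots> = a \<otimes> v s \<oplus> B"
        unfolding v_def B_def using l u evc a by (intro finsum_combination) auto
      finally have "a \<otimes> v s \<oplus> B = (\<Oplus>i\<in>{..<N}. l i [^] e \<otimes> (pencil (a # xs) (l i) \<otimes> u i))" ..
      also have "\<dots> \<in> ideal_power R I (Suc (Suc j))"
        by (intro ideal_finsum_mem ideal_power_ideal I
              ideal.I_l_closed[OF ideal_power_ideal[OF I] ann]) (use l in auto)
      finally have "a [^] e \<otimes> (a \<otimes> v s \<oplus> B) \<in> ideal_power R I (Suc (Suc (j + e)))"
        by (intro ideal_power_mult[OF I ideal_nat_pow_mem[OF I a(1)]]) auto
      moreover have "a [^] e \<otimes> B \<in> ideal_power R I (Suc (Suc (j + e)))"
        unfolding B_def using Suc.IH a xs' l u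
        by (intro pencil_moments_mem[OF I]) (auto simp: v_def)
      ultimately have "a [^] e \<otimes> (a \<otimes> v s \<oplus> B) \<ominus> a [^] e \<otimes> B \<in> ideal_power R I (Suc (Suc (j + e)))"
        by (intro ideal_minus_mem ideal_power_ideal I)
      moreover have "a [^] e \<otimes> (a \<otimes> v s \<oplus> B) \<ominus> a [^] e \<otimes> B = a [^] Suc e \<otimes> v s"
      proof -
        have "a [^] e \<in> carrier R" using a by simp
        then show ?thesis unfolding nat_pow_Suc using a(2) v[of s] B by algebra
      qed
      ultimately show ?thesis by simp
    qed
  qed
  \<comment> \<open>\<open>P e\<close> says that \<open>a [^] e\<close> kills the whole tuple. It
    fails for 0 and holds for \<open>N\<close>; at an exponent where it switches, the tuple
    \<open>a [^] e \<otimes> u i\<close> is still nonzero but killed by \<open>a\<close>.\<close>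
  define P where "P e \<longleftrightarrow> (\<forall>i<N. a [^] e \<otimes> u i \<in> ideal_power R I (Suc (j + e)))" for e :: nat
  \<comment> \<open>\<open>a [^] N\<close> kills at least the first \<open>N\<close> moments, as
    many as there are entries.\<close>
  have "P N"
    unfolding P_def
  proof (intro allI impI)
    fix k assume k: "k < N"
    show "a [^] N \<otimes> u k \<in> ideal_power R I (Suc (j + N))"
    proof (rule vandermonde_mem[of _ l "\<lambda>i. a [^] N \<otimes> u i", OF ideal_power_ideal[OF I] l _ diff _ k])
      show "a [^] N \<otimes> u i \<in> carrier R" for i using a u by simp
      show "(\<Oplus>i\<in>{..<N}. l i [^] s \<otimes> (a [^] N \<otimes> u i)) \<in> ideal_power R I (Suc (j + N))"
        if "s < N" for s
      proof -
        have "(\<Oplus>i\<in>{..<N}. l i [^] s \<otimes> (a [^] N \<otimes> u i)) =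
              (\<Oplus>i\<in>{..<N}. a [^] N \<otimes> (l i [^] s \<otimes> u i))"
          using l u a by (intro finsum_cong') (auto simp: m_lcomm)
        also have "\<dots> = a [^] N \<otimes> v s"
          unfolding v_def using l u a by (intro finsum_rdistr[symmetric]) auto
        finally show ?thesis using lead[of s N] that by simp
      qed
    qed
  qed
  moreover have "\<not> P 0" using nz u by (auto simp: P_def)
  ultimately obtain e where "\<not> P e" "P (Suc e)"
    using nat_induct[of "\<lambda>e. \<not> P e" N] by blast
  moreover have "a [^] Suc e \<otimes> u i = a \<otimes> (a [^] e \<otimes> u i)" for i
    using a u by (simp add: m_ac)
  ultimately show ?thesis
    using that[of e] by (auto simp: P_def)
qed

text \<open>Induction on the list: once the head kills the tuple
  \<open>w i = a [^] e \<otimes> u i\<close>, the pencil of the tail alone annihilates it, and its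
  moments are \<open>a [^] e\<close> times the old ones and so still vanish. The factors collected
  on the way form \<open>r\<close>, the same for all entries; this is what keeps the relations
  between the entries intact.\<close>

lemma pencil_annihilator:
  fixes N :: nat
  assumes I: "ideal I R" and l: "\<And>i. l i \<in> carrier R"
    and diff: "\<And>i k. i < N \<Longrightarrow> k < N \<Longrightarrow> i \<noteq> k \<Longrightarrow> l i \<ominus> l k \<in> Units R"
    and "\<And>i. u i \<in> ideal_power R I j"
    and "set xs \<subseteq> I"
    and "\<And>i. i < N \<Longrightarrow> pencil xs (l i) \<otimes> u i \<in> ideal_power R I (Suc (Suc j))"
    and "\<And>s. s < length xs \<Longrightarrow> (\<Oplus>i\<in>{..<N}. l i [^] s \<otimes> u i) \<in> ideal_power R I (Suc j)"
    and "\<exists>i<N. u i \<notin> ideal_power R I (Suc j)"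
  shows "\<exists>k. \<exists>r\<in>ideal_power R I k. (\<exists>i<N. r \<otimes> u i \<notin> ideal_power R I (Suc (j + k))) \<and>
    (\<forall>x\<in>set xs. \<forall>i<N. x \<otimes> (r \<otimes> u i) \<in> ideal_power R I (Suc (Suc (j + k))))"
  using assms(4-)
proof (induction xs arbitrary: u j)
  case Nil
  then show ?case
    using ideal_power_carrier[OF I Nil.prems(1)] by (intro exI[of _ 0] bexI[of _ \<one>]) auto
next
  case (Cons a xs)
  have a: "a \<in> I" "a \<in> carrier R" and xs: "set xs \<subseteq> carrier R" "set xs \<subseteq> I"
    using Cons.prems(2) ideal.Icarr[OF I] by auto
  have u: "u i \<in> carrier R" for i using ideal_power_carrier[OF I Cons.prems(1)] .
  have evc: "pencil xs (l i) \<in> carrier R" for i using pencil_closed[OF xs(1) l] .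
  obtain e where e: "\<exists>i<N. a [^] e \<otimes> u i \<notin> ideal_power R I (Suc (j + e))"
    "\<And>i. i < N \<Longrightarrow> a \<otimes> (a [^] e \<otimes> u i) \<in> ideal_power R I (Suc (Suc (j + e)))"
  proof (rule pencil_head_annihilator[of I l N u a xs j])
    show "(\<Oplus>i\<in>{..<N}. l i [^] s \<otimes> u i) \<in> ideal_power R I (Suc j)" if "s < length xs" for s
      using Cons.prems(4) that by simp
  qed (use I l diff u Cons.prems in \<open>simp_all del: pencil.simps\<close>)
  define w where "w i = a [^] e \<otimes> u i" for i
  have ae: "a [^] e \<in> ideal_power R I e" "a [^] e \<in> carrier R"
    using ideal_nat_pow_mem[OF I a(1)] a by auto
  have w: "w i \<in> ideal_power R I (j + e)" for i
    unfolding w_def using ideal_power_mult[OF I ae(1) Cons.prems(1)] by (simp add: add.commute)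
  have "\<exists>k. \<exists>r\<in>ideal_power R I k. (\<exists>i<N. r \<otimes> w i \<notin> ideal_power R I (Suc (j + e + k))) \<and>
    (\<forall>x\<in>set xs. \<forall>i<N. x \<otimes> (r \<otimes> w i) \<in> ideal_power R I (Suc (Suc (j + e + k))))"
  proof (rule Cons.IH[of w "j + e", OF w xs(2)])
    fix i assume i: "i < N"
    \<comment> \<open>The head term is subtracted; it vanishes in this degree because
      \<open>a\<close> kills \<open>w i\<close>.\<close>
    have "pencil xs (l i) \<otimes> w i =
        a [^] e \<otimes> (pencil (a # xs) (l i) \<otimes> u i) \<ominus> l i [^] length xs \<otimes> (a \<otimes> (a [^] e \<otimes> u i))"
    proof -
      have "l i [^] length xs \<in> carrier R" "u i \<in> carrier R" "pencil xs (l i) \<in> carrier R"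
        using l u evc by auto
      then show ?thesis
        unfolding pencil.simps(2) w_def using a(2) ae(2) by algebra
    qed
    also have "\<dots> \<in> ideal_power R I (Suc (Suc (j + e)))"
    proof (intro ideal_minus_mem ideal_power_ideal I)
      show "a [^] e \<otimes> (pencil (a # xs) (l i) \<otimes> u i) \<in> ideal_power R I (Suc (Suc (j + e)))"
        using Cons.prems(3)[OF i] by (intro ideal_power_mult[OF I ae(1)]) auto
      show "l i [^] length xs \<otimes> (a \<otimes> (a [^] e \<otimes> u i)) \<in> ideal_power R I (Suc (Suc (j + e)))"
        by (rule ideal.I_l_closed[OF ideal_power_ideal[OF I] e(2)[OF i]]) (use l in simp)
    qed
    finally show "pencil xs (l i) \<otimes> w i \<in> ideal_power R I (Suc (Suc (j + e)))" .
  next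
    fix s assume s: "s < length xs"
    have "(\<Oplus>i\<in>{..<N}. l i [^] s \<otimes> w i) = (\<Oplus>i\<in>{..<N}. a [^] e \<otimes> (l i [^] s \<otimes> u i))"
      unfolding w_def using l u a by (intro finsum_cong') (auto simp: m_lcomm)
    also have "\<dots> = a [^] e \<otimes> (\<Oplus>i\<in>{..<N}. l i [^] s \<otimes> u i)"
      using l u a by (intro finsum_rdistr[symmetric]) auto
    also have "\<dots> \<in> ideal_power R I (Suc (j + e))"
      using Cons.prems(4)[of s] s by (intro ideal_power_mult[OF I ae(1)]) auto
    finally show "(\<Oplus>i\<in>{..<N}. l i [^] s \<otimes> w i) \<in> ideal_power R I (Suc (j + e))" .
  qed (use e(1) in \<open>simp add: w_def\<close>)
  then obtain k r where r: "r \<in> ideal_power R I k"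
    and nz: "\<exists>i<N. r \<otimes> w i \<notin> ideal_power R I (Suc (j + e + k))"
    and ann: "\<And>x i. x \<in> set xs \<Longrightarrow> i < N \<Longrightarrow> x \<otimes> (r \<otimes> w i) \<in> ideal_power R I (Suc (Suc (j + e + k)))"
    by blast
  have rc: "r \<in> carrier R" using ideal_power_carrier[OF I r] .
  have rw: "(r \<otimes> a [^] e) \<otimes> u i = r \<otimes> w i" for i
    using rc ae(2) u by (simp add: w_def m_assoc)
  have re: "r \<otimes> a [^] e \<in> ideal_power R I (e + k)"
    by (rule ideal_power_mult[OF I r ae(1)]) simp
  have "a \<otimes> (r \<otimes> w i) \<in> ideal_power R I (Suc (Suc (j + e + k)))" if "i < N" for i
  proof -
    have "a \<otimes> (r \<otimes> w i) = r \<otimes> (a \<otimes> (a [^] e \<otimes> u i))"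
      unfolding w_def using rc a u by (simp add: m_lcomm)
    then show ?thesis
      using ideal_power_mult[OF I r e(2)[OF that]] by (simp add: ac_simps)
  qed
  then show ?case
    using nz ann re unfolding rw[symmetric] by (intro exI[of _ "e + k"] bexI[of _ "r \<otimes> a [^] e"])
      (auto simp: add.assoc)
qed


section \<open>Linear dependencies over a noetherian ring and superficial elements\<close>

lemma idealI_combination:
  assumes "A \<subseteq> carrier R" "\<zero> \<in> A"
    and "\<And>r a b. r \<in> carrier R \<Longrightarrow> a \<in> A \<Longrightarrow> b \<in> A \<Longrightarrow> r \<otimes> a \<oplus> b \<in> A"
  shows "ideal A R"
proof -
  have mult: "r \<otimes> a \<in> A" if "r \<in> carrier R" "a \<in> A" for r a
    using assms(3)[OF that assms(2)] assms(1) that by auto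
  show ?thesis
  proof (rule idealI[OF ring_axioms])
    show "subgroup A (add_monoid R)"
    proof (rule add.subgroupI)
      show "\<ominus> a \<in> A" if "a \<in> A" for a
      proof -
        have "\<ominus> a = (\<ominus> \<one>) \<otimes> a" using that assms(1) by (auto simp: l_minus)
        then show ?thesis using mult[of "\<ominus> \<one>" a] that by simp
      qed
      show "a \<oplus> b \<in> A" if "a \<in> A" "b \<in> A" for a b
      proof -
        have "a \<in> carrier R" using that assms(1) by auto
        then show ?thesis using assms(3)[of \<one> a b] that by simp
      qed
    qed (use assms in auto)
    show "r \<otimes> a \<in> A" if "a \<in> A" "r \<in> carrier R" for a r using mult that by simp
    show "a \<otimes> r \<in> A" if "a \<in> A" "r \<in> carrier R" for a r
    proof -
      have "a \<in> carrier R" using that assms(1) by auto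
      then show ?thesis using mult[of r a] that by (simp add: m_comm)
    qed
  qed
qed

lemma finsum_split:
  assumes "\<And>i. f i \<in> carrier R"
  shows "(\<Oplus>i\<in>{..<m + n :: nat}. f i) = (\<Oplus>i\<in>{..<m}. f i) \<oplus> (\<Oplus>i\<in>{..<n}. f (m + i))"
proof (induction n)
  case 0
  then show ?case using assms by simp
next
  case (Suc n)
  have c: "f (m + n) \<in> carrier R" "(\<Oplus>i\<in>{..<m}. f i) \<in> carrier R"
    "(\<Oplus>i\<in>{..<n}. f (m + i)) \<in> carrier R"
    using assms by (auto intro!: finsum_closed)
  have "(\<Oplus>i\<in>{..<m + Suc n}. f i) = f (m + n) \<oplus> (\<Oplus>i\<in>{..<m + n}. f i)"
    using assms by (simp add: lessThan_Suc finsum_insert Pi_def)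
  also have "\<dots> = (\<Oplus>i\<in>{..<m}. f i) \<oplus> (f (m + n) \<oplus> (\<Oplus>i\<in>{..<n}. f (m + i)))"
    unfolding Suc.IH using c by (simp add: a_lcomm)
  also have "f (m + n) \<oplus> (\<Oplus>i\<in>{..<n}. f (m + i)) = (\<Oplus>i\<in>{..<Suc n}. f (m + i))"
    using assms by (simp add: lessThan_Suc finsum_insert Pi_def)
  finally show ?case .
qed

text \<open>This is the noetherian property of the free module of rank \<open>D\<close>, applied to
  the vectors \<open>z i\<close>; the coefficient of \<open>z N\<close> in the relation is 1.
  Induction on \<open>D\<close>: the ideals \<open>A n\<close> of last coordinates of those
  combinations of the first \<open>n\<close> vectors whose other coordinates vanish form an
  ascending chain, constant from some \<open>n\<close> on. A dependency of the shifted sequence in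
  the first \<open>D\<close> coordinates has a defect in the last one; the defect lies in a later
  ideal of the chain, hence in \<open>A n\<close>, and is corrected by the first \<open>n\<close>
  vectors.\<close>

lemma noetherian_dependency:
  fixes D :: nat and z :: "nat \<Rightarrow> nat \<Rightarrow> 'a"
  assumes "noetherian_ring R" and "\<And>i s. z i s \<in> carrier R"
  shows "\<exists>N c. (\<forall>i. c i \<in> carrier R) \<and> (\<forall>s<D. z N s = (\<Oplus>i\<in>{..<N}. c i \<otimes> z i s))"
  using assms(2)
proof (induction D arbitrary: z)
  case 0
  then show ?case by (intro exI[of _ 0] exI[of _ "\<lambda>_. \<zero>"]) auto
next
  case (Suc D)
  note z = Suc.prems
  define S where "S n c s = (\<Oplus>i\<in>{..<n}. c i \<otimes> z i s)" for n :: nat and c and s :: nat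
  have S: "S n c s \<in> carrier R" if "\<And>i. c i \<in> carrier R" for n c s
    unfolding S_def using that z by (auto intro!: finsum_closed)
  have S_lin: "S n (\<lambda>i. r \<otimes> c i \<oplus> d i) s = r \<otimes> S n c s \<oplus> S n d s"
    if "\<And>i. c i \<in> carrier R" "\<And>i. d i \<in> carrier R" "r \<in> carrier R" for n r c d s
  proof -
    have "S n (\<lambda>i. r \<otimes> c i \<oplus> d i) s = (\<Oplus>i\<in>{..<n}. r \<otimes> (c i \<otimes> z i s) \<oplus> d i \<otimes> z i s)"
      unfolding S_def using that z by (intro finsum_cong') (auto simp: l_distr m_assoc)
    also have "\<dots> = r \<otimes> S n c s \<oplus> S n d s"
      unfolding S_def by (rule finsum_combination) (use that z in auto)
    finally show ?thesis .
  qed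
  define K where "K n = {c. (\<forall>i. c i \<in> carrier R) \<and> (\<forall>s<D. S n c s = \<zero>)}" for n
  define A where "A n = (\<lambda>c. S n c D) ` K n" for n
  have S_zero: "S n (\<lambda>_. \<zero>) s = \<zero>" for n s
    unfolding S_def using z by simp
  have A_ideal: "ideal (A n) R" for n
  proof (rule idealI_combination)
    show "A n \<subseteq> carrier R" using S by (auto simp: A_def K_def)
    show "\<zero> \<in> A n"
      unfolding A_def using S_zero by (intro image_eqI[of _ _ "\<lambda>_. \<zero>"]) (auto simp: K_def)
    fix r a b assume r: "r \<in> carrier R" and ab: "a \<in> A n" "b \<in> A n"
    then obtain c d where cd: "c \<in> K n" "d \<in> K n" "a = S n c D" "b = S n d D"
      by (auto simp: A_def)
    then show "r \<otimes> a \<oplus> b \<in> A n"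
      unfolding A_def using r S_lin[of c d r]
      by (intro image_eqI[of _ _ "\<lambda>i. r \<otimes> c i \<oplus> d i"]) (auto simp: K_def)
  qed
  have A_mono: "A n \<subseteq> A (Suc n)" for n
  proof
    fix a assume "a \<in> A n"
    then obtain c where c: "c \<in> K n" "a = S n c D" by (auto simp: A_def)
    have "S (Suc n) (c(n := \<zero>)) s = S n c s" for s
    proof -
      have "(\<Oplus>i\<in>{..<n}. (c(n := \<zero>)) i \<otimes> z i s) = S n c s"
        unfolding S_def using c z by (intro finsum_cong') (auto simp: K_def)
      then show ?thesis
        using c z S[of c n s] by (simp add: S_def[of "Suc n"] lessThan_Suc finsum_insert Pi_def K_def)
    qed
    then show "a \<in> A (Suc n)"
      unfolding A_def using c by (intro image_eqI[of _ _ "c(n := \<zero>)"]) (auto simp: K_def)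
  qed
  then have mono: "A m \<subseteq> A n" if "m \<le> n" for m n
    using that by (rule lift_Suc_mono_le)
  have "\<Union>(range A) \<in> range A"
  proof (rule noetherian_ring.ideal_chain_is_trivial[OF assms(1)])
    show "subset.chain {I. ideal I R} (range A)"
      unfolding subset.chain_def using A_ideal mono nat_le_linear by blast
  qed simp
  then obtain n where n: "A m \<subseteq> A n" for m by blast
  \<comment> \<open>The shift by \<open>n\<close> leaves the first \<open>n\<close> vectors free for
    the correction.\<close>
  obtain N c where c: "\<And>i. c i \<in> carrier R"
    and dep: "\<And>s. s < D \<Longrightarrow> z (n + N) s = (\<Oplus>i\<in>{..<N}. c i \<otimes> z (n + i) s)"
    using Suc.IH[of "\<lambda>i. z (n + i)"] z by blast
  define T where "T s = (\<Oplus>i\<in>{..<N}. c i \<otimes> z (n + i) s)" for s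
  have T: "T s \<in> carrier R" for s
    unfolding T_def using c z by (auto intro!: finsum_closed)
  \<comment> \<open>Coefficients of the relation \<open>z (n + N) - T\<close>, which vanishes in the
    first \<open>D\<close> coordinates; its last coordinate is the defect.\<close>
  define d where "d i = (if i < n then \<zero> else if i < n + N then \<ominus> c (i - n) else \<one>)" for i
  have d: "d i \<in> carrier R" for i using c by (simp add: d_def)
  have Sd: "S (Suc (n + N)) d s = z (n + N) s \<ominus> T s" for s
  proof -
    have "(\<Oplus>i\<in>{..<n}. d i \<otimes> z i s) = (\<Oplus>i\<in>{..<n}. \<zero>)"
      using z by (intro finsum_cong') (auto simp: d_def)
    moreover have "(\<Oplus>i\<in>{..<N}. d (n + i) \<otimes> z (n + i) s) = (\<Oplus>i\<in>{..<N}. (\<ominus> \<one>) \<otimes> (c i \<otimes> z (n + i) s))"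
      using z c by (intro finsum_cong') (auto simp: d_def l_minus)
    moreover have "\<dots> = (\<ominus> \<one>) \<otimes> T s"
      unfolding T_def by (rule finsum_rdistr[symmetric]) (use c z in auto)
    ultimately have "S (n + N) d s = \<ominus> T s"
      unfolding S_def using finsum_split[of "\<lambda>i. d i \<otimes> z i s" n N] d z T[of s] by (simp add: l_minus)
    moreover have "S (Suc (n + N)) d s = z (n + N) s \<oplus> S (n + N) d s"
      using d z by (simp add: S_def lessThan_Suc finsum_insert Pi_def) (simp add: d_def z)
    ultimately show ?thesis by (simp add: a_minus_def)
  qed
  have "d \<in> K (Suc (n + N))"
    unfolding K_def using d Sd dep T by (simp add: T_def r_neg a_minus_def)
  then have "S (Suc (n + N)) d D \<in> A (Suc (n + N))" by (simp add: A_def)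
  then have "z (n + N) D \<ominus> T D \<in> A n"
    using n Sd[of D] by auto
  then obtain e where e: "e \<in> K n" "z (n + N) D \<ominus> T D = S n e D"
    by (auto simp: A_def)
  then have ec: "e i \<in> carrier R" for i by (simp add: K_def)
  \<comment> \<open>The correction \<open>e\<close> on the first \<open>n\<close> vectors, followed
    by the dependency \<open>c\<close> of the shifted ones.\<close>
  define b where "b i = (if i < n then e i else c (i - n))" for i
  have b: "b i \<in> carrier R" for i using c ec by (simp add: b_def)
  have "z (n + N) s = S (n + N) b s" if "s < Suc D" for s
  proof -
    have "(\<Oplus>i\<in>{..<n}. b i \<otimes> z i s) = S n e s"
      unfolding S_def using z ec by (intro finsum_cong') (auto simp: b_def)
    moreover have "(\<Oplus>i\<in>{..<N}. b (n + i) \<otimes> z (n + i) s) = T s"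
      unfolding T_def using z c by (intro finsum_cong') (auto simp: b_def)
    ultimately have eq: "S (n + N) b s = S n e s \<oplus> T s"
      unfolding S_def[of "n + N"] using finsum_split[of "\<lambda>i. b i \<otimes> z i s" n N] b z by simp
    show ?thesis
    proof (cases "s = D")
      case True
      have "(z (n + N) D \<ominus> T D) \<oplus> T D = z (n + N) D"
        using z[of "n + N" D] T[of D] by algebra
      then show ?thesis using eq e(2) True by simp
    next
      case False
      then have "s < D" using that by simp
      then show ?thesis using eq e(1) dep[of s] T[of s] by (simp add: K_def T_def)
    qed
  qed
  then show ?case using b by (intro exI[of _ "n + N"] exI[of _ b]) (auto simp: S_def)
qed

lemma pencil_mem_ideal:
  assumes "ideal I R" "set ys \<subseteq> I" "x \<in> carrier R"
  shows "pencil ys x \<in> I"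
  using assms(2)
  by (induction ys)
    (auto simp: pencil.simps(2) ideal_zero_mem[OF assms(1)]
      intro!: ideal_add_mem[OF assms(1)] ideal.I_r_closed[OF assms(1)] nat_pow_closed assms(3))

text \<open>\<open>no_ann\<close> is the shape in which positive depth is used. If there is no
  \<open>x\<close> for the degree \<open>j\<close>, each point of the pencil at \<open>l i\<close>
  kills some nonzero form \<open>w i\<close> of degree \<open>j\<close>; a combination of finitely
  many of these satisfies the hypotheses of \<open>pencil_annihilator\<close>, which yields a form
  that contradicts \<open>no_ann\<close>, possibly in a higher degree.\<close>

lemma exists_superficial:
  assumes noeth: "noetherian_ring R" and I: "ideal I R"
    and l: "\<And>i :: nat. l i \<in> carrier R"
    and diff: "\<And>i k. i \<noteq> k \<Longrightarrow> l i \<ominus> l k \<in> Units R"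
    and no_ann: "\<And>k w. w \<in> ideal_power R I k \<Longrightarrow>
      (\<And>x. x \<in> I \<Longrightarrow> x \<otimes> w \<in> ideal_power R I (Suc (Suc k))) \<Longrightarrow> w \<in> ideal_power R I (Suc k)"
  shows "\<exists>x\<in>I. \<forall>w\<in>ideal_power R I j.
    x \<otimes> w \<in> ideal_power R I (Suc (Suc j)) \<longrightarrow> w \<in> ideal_power R I (Suc j)"
proof (rule ccontr)
  assume contra: "\<not> ?thesis"
  obtain xs where xs: "set xs \<subseteq> carrier R" "I = Idl (set xs)"
    using noetherian_ring.finetely_gen[OF noeth I] finite_list by blast
  then have xsI: "set xs \<subseteq> I" using genideal_self by simp
  have "\<forall>i. \<exists>w\<in>ideal_power R I j. pencil xs (l i) \<otimes> w \<in> ideal_power R I (Suc (Suc j)) \<and>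
      w \<notin> ideal_power R I (Suc j)"
    using contra pencil_mem_ideal[OF I xsI l] by blast
  then obtain w where w: "\<And>i. w i \<in> ideal_power R I j"
    and ann: "\<And>i. pencil xs (l i) \<otimes> w i \<in> ideal_power R I (Suc (Suc j))"
    and nz: "\<And>i. w i \<notin> ideal_power R I (Suc j)"
    by metis
  have wc: "w i \<in> carrier R" for i using ideal_power_carrier[OF I w] .
  have evc: "pencil xs (l i) \<in> carrier R" for i using pencil_closed[OF xs(1) l] .
  \<comment> \<open>The dependency is taken between the vectors with coordinates
    \<open>l i [^] s \<otimes> w i\<close> for \<open>s < length xs\<close>, so that one choice of
    coefficients serves all these moments.\<close>
  obtain N c where c: "\<And>i. c i \<in> carrier R"
    and dep: "\<And>s. s < length xs \<Longrightarrow>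
      l N [^] s \<otimes> w N = (\<Oplus>i\<in>{..<N}. c i \<otimes> (l i [^] s \<otimes> w i))"
    using noetherian_dependency[OF noeth, of "\<lambda>i s. l i [^] s \<otimes> w i" "length xs"] l wc by auto
  \<comment> \<open>The moments of \<open>u\<close> are zero already in \<open>R\<close>. Scaling
    preserves the annihilation of each entry by its own point, and the coefficient
    \<open>\<ominus> \<one>\<close> keeps the last entry a nonzero form.\<close>
  define u where "u i = (if i = N then \<ominus> \<one> else c i) \<otimes> w i" for i
  have ui: "u i \<in> ideal_power R I j" for i
    unfolding u_def using c by (intro ideal.I_l_closed[OF ideal_power_ideal[OF I] w]) simp
  have "\<exists>k. \<exists>r\<in>ideal_power R I k. (\<exists>i<Suc N. r \<otimes> u i \<notin> ideal_power R I (Suc (j + k))) \<and>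
    (\<forall>x\<in>set xs. \<forall>i<Suc N. x \<otimes> (r \<otimes> u i) \<in> ideal_power R I (Suc (Suc (j + k))))"
  proof (rule pencil_annihilator[OF I l diff ui xsI])
    show "pencil xs (l i) \<otimes> u i \<in> ideal_power R I (Suc (Suc j))" for i
    proof -
      have "pencil xs (l i) \<otimes> u i = (if i = N then \<ominus> \<one> else c i) \<otimes> (pencil xs (l i) \<otimes> w i)"
        unfolding u_def using evc wc c by (intro m_lcomm) auto
      also have "\<dots> \<in> ideal_power R I (Suc (Suc j))"
        using c by (intro ideal.I_l_closed[OF ideal_power_ideal[OF I] ann]) simp
      finally show ?thesis .
    qed
    show "(\<Oplus>i\<in>{..<Suc N}. l i [^] s \<otimes> u i) \<in> ideal_power R I (Suc j)" if "s < length xs" for s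
    proof -
      have uc: "u i \<in> carrier R" for i unfolding u_def using wc c by simp
      have "(\<Oplus>i\<in>{..<N}. l i [^] s \<otimes> u i) = (\<Oplus>i\<in>{..<N}. c i \<otimes> (l i [^] s \<otimes> w i))"
        using l wc c by (intro finsum_cong') (auto simp: u_def m_lcomm)
      also have "\<dots> = l N [^] s \<otimes> w N" using dep[OF that] ..
      finally have "(\<Oplus>i\<in>{..<Suc N}. l i [^] s \<otimes> u i) = l N [^] s \<otimes> u N \<oplus> l N [^] s \<otimes> w N"
        using l uc by (simp add: lessThan_Suc finsum_insert Pi_def)
      also have "\<dots> = \<zero>"
        using l wc by (simp add: u_def l_minus r_minus l_neg)
      finally show ?thesis using ideal_zero_mem[OF ideal_power_ideal[OF I]] by simp
    qed
    have "\<ominus> \<one> \<otimes> u N = w N" using wc by (simp add: u_def l_minus)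
    then have "u N \<notin> ideal_power R I (Suc j)"
      using nz[of N] ideal.I_l_closed[OF ideal_power_ideal[OF I], of "u N" "Suc j" "\<ominus> \<one>"] by auto
    then show "\<exists>i<Suc N. u i \<notin> ideal_power R I (Suc j)" by blast
  qed auto
  then obtain k r i where r: "r \<in> ideal_power R I k"
    and ri: "r \<otimes> u i \<notin> ideal_power R I (Suc (j + k))"
    and kill: "\<And>x. x \<in> set xs \<Longrightarrow> x \<otimes> (r \<otimes> u i) \<in> ideal_power R I (Suc (Suc (j + k)))"
    by blast
  have mem: "r \<otimes> u i \<in> ideal_power R I (j + k)"
    using ideal_power_mult[OF I r ui] by (simp add: add.commute)
  have mc: "r \<otimes> u i \<in> carrier R" using ideal_power_carrier[OF I mem] .
  have "Idl (set xs) \<subseteq> {a \<in> carrier R. a \<otimes> (r \<otimes> u i) \<in> ideal_power R I (Suc (Suc (j + k)))}"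
    by (rule genideal_minimal[OF ideal_colon[OF ideal_power_ideal[OF I] mc]])
      (use kill xs(1) in auto)
  then show False using no_ann[OF mem] ri xs(2) by blast
qed


subsection \<open>The associated graded ring\<close>

lemma rcos_eq_iff: "ideal I R \<Longrightarrow> a \<in> carrier R \<Longrightarrow> b \<in> carrier R \<Longrightarrow> I +> a = I +> b \<longleftrightarrow> a \<ominus> b \<in> I"
  using quotient_eq_iff_same_a_r_cos by blast

lemma rcos_zero: "ideal I R \<Longrightarrow> I +> \<zero> = I"
  by (simp add: additive_subgroup.a_subset ideal.axioms(1) a_coset_add_zero)

lemma rcos_eq_self_iff: "ideal I R \<Longrightarrow> a \<in> carrier R \<Longrightarrow> I +> a = I \<longleftrightarrow> a \<in> I"
  using rcos_eq_iff[of I a \<zero>] by (simp add: rcos_zero minus_eq)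

text \<open>The factors are cosets of different ideals, so this is not multiplication in one
  quotient ring. Changing representatives by \<open>g\<close> and \<open>h\<close> changes the
  product by \<open>g h + g y + x h\<close>, and each of these terms lies in degree
  \<open>Suc n\<close>.\<close>

lemma graded_rcoset_mult:
  assumes I: "ideal I R" and x: "x \<in> ideal_power R I i" and y: "y \<in> ideal_power R I j"
    and n: "i + j = n"
  shows "rcoset_mult R (ideal_power R I (Suc n)) (ideal_power R I (Suc i) +> x) (ideal_power R I (Suc j) +> y)
    = ideal_power R I (Suc n) +> (x \<otimes> y)"
proof -
  note pI = ideal_power_ideal[OF I]
  have xy: "x \<in> carrier R" "y \<in> carrier R" using x y ideal_power_carrier[OF I] by auto
  have *: "ideal_power R I (Suc n) +> (a \<otimes> b) = ideal_power R I (Suc n) +> (x \<otimes> y)"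
    if ab: "a \<in> ideal_power R I (Suc i) +> x" "b \<in> ideal_power R I (Suc j) +> y" for a b
  proof -
    obtain g h where g: "g \<in> ideal_power R I (Suc i)" "a = g \<oplus> x"
      and h: "h \<in> ideal_power R I (Suc j)" "b = h \<oplus> y"
      using ab by (auto simp: a_r_coset_def r_coset_def)
    have gh: "g \<in> carrier R" "h \<in> carrier R"
      using g h ideal_power_carrier[OF I] by auto
    have h': "h \<in> ideal_power R I j"
      using h(1) ideal_power_antimono[OF I, of j "Suc j"] by auto
    have "a \<otimes> b \<ominus> x \<otimes> y = g \<otimes> h \<oplus> (g \<otimes> y \<oplus> x \<otimes> h)"
      unfolding g(2) h(2) using xy gh by algebra
    also have "\<dots> \<in> ideal_power R I (Suc n)"
      using n by (intro ideal_add_mem pI ideal_power_mult[OF I g(1) h'] ideal_power_mult[OF I g(1) y]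
          ideal_power_mult[OF I x h(1)]) auto
    finally show ?thesis
      using xy gh g(2) h(2) by (subst rcos_eq_iff[OF pI]) auto
  qed
  have self: "x \<in> ideal_power R I (Suc i) +> x" "y \<in> ideal_power R I (Suc j) +> y"
    using xy abelian_subgroup.a_rcos_self[OF abelian_subgroupI3[OF ideal.axioms(1)[OF pI] abelian_group_axioms]]
    by auto
  show ?thesis
    unfolding rcoset_mult_def using * self by blast
qed

text \<open>The Rees algebra of \<open>I\<close> inside the polynomial ring, whose elements are
  coefficient functions. The associated graded ring is its image under \<open>leading_forms\<close>,
  so the ring axioms need not be verified for the convolution of cosets.\<close>

definition rees_carrier :: "'a set \<Rightarrow> (nat \<Rightarrow> 'a) set" where
  "rees_carrier I = {p \<in> carrier (UP R). \<forall>i. p i \<in> ideal_power R I i}"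

definition leading_forms :: "'a set \<Rightarrow> (nat \<Rightarrow> 'a) \<Rightarrow> nat \<Rightarrow> 'a set" where
  "leading_forms I p = (\<lambda>i. ideal_power R I (Suc i) +> p i)"

lemma rees_subring:
  assumes I: "ideal I R"
  shows "subring (rees_carrier I) (UP R)"
proof -
  interpret U: UP_cring R "UP R" by unfold_locales
  note pI = ideal_power_ideal[OF I]
  have coeff: "up_ring.coeff (UP R) p = p" if "p \<in> carrier (UP R)" for p
    using that by (simp add: UP_def)
  show ?thesis
  proof (rule U.P.subringI)
    show "rees_carrier I \<subseteq> carrier (UP R)" by (auto simp: rees_carrier_def)
    show "\<one>\<^bsub>UP R\<^esub> \<in> rees_carrier I"
      using U.coeff_one coeff[OF U.P.one_closed] ideal_zero_mem[OF pI]
      by (auto simp: rees_carrier_def)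
    show "\<ominus>\<^bsub>UP R\<^esub> h \<in> rees_carrier I" if "h \<in> rees_carrier I" for h
      using that U.coeff_a_inv[of h] coeff[of h] coeff[of "\<ominus>\<^bsub>UP R\<^esub> h"] ideal_neg_mem[OF pI]
      by (auto simp: rees_carrier_def)
    show "g \<otimes>\<^bsub>UP R\<^esub> h \<in> rees_carrier I" if "g \<in> rees_carrier I" "h \<in> rees_carrier I" for g h
    proof -
      have gh: "g \<in> carrier (UP R)" "h \<in> carrier (UP R)" using that by (auto simp: rees_carrier_def)
      have "(g \<otimes>\<^bsub>UP R\<^esub> h) n \<in> ideal_power R I n" for n
      proof -
        have "(g \<otimes>\<^bsub>UP R\<^esub> h) n = (\<Oplus>i\<in>{..n}. g i \<otimes> h (n - i))"
          using U.coeff_mult[OF gh, of n] coeff gh by simp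
        also have "\<dots> \<in> ideal_power R I n"
          using that by (intro ideal_finsum_mem pI) (auto intro!: ideal_power_mult[OF I] simp: rees_carrier_def)
        finally show ?thesis .
      qed
      then show ?thesis using gh by (auto simp: rees_carrier_def)
    qed
    show "g \<oplus>\<^bsub>UP R\<^esub> h \<in> rees_carrier I" if "g \<in> rees_carrier I" "h \<in> rees_carrier I" for g h
    proof -
      have gh: "g \<in> carrier (UP R)" "h \<in> carrier (UP R)" using that by (auto simp: rees_carrier_def)
      then show ?thesis
        using that U.coeff_add[OF gh] coeff[of g] coeff[of h] coeff[of "g \<oplus>\<^bsub>UP R\<^esub> h"] ideal_add_mem[OF pI]
        by (auto simp: rees_carrier_def)
    qed
  qed
qed

lemma leading_forms_hom:
  assumes I: "ideal I R"
  shows "leading_forms I \<in> ring_hom (UP R\<lparr>carrier := rees_carrier I\<rparr>) (assoc_graded R I)"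
proof -
  interpret U: UP_cring R "UP R" by unfold_locales
  note pI = ideal_power_ideal[OF I]
  have coeff: "up_ring.coeff (UP R) p = p" if "p \<in> carrier (UP R)" for p
    using that by (simp add: UP_def)
  show ?thesis
  proof (rule ring_hom_memI, simp_all)
    fix p assume p: "p \<in> rees_carrier I"
    then have pc: "p \<in> up R" by (simp add: rees_carrier_def UP_def)
    then obtain n where "bound \<zero> n p" by auto
    then have "{i. leading_forms I p i \<noteq> ideal_power R I (Suc i)} \<subseteq> {..n}"
      using rcos_zero[OF pI] by (force simp: leading_forms_def bound_def)
    then show "leading_forms I p \<in> carrier (assoc_graded R I)"
      using p finite_subset by (auto simp: assoc_graded_def leading_forms_def rees_carrier_def)
  next
    fix p q assume pq: "p \<in> rees_carrier I" "q \<in> rees_carrier I"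
    have pqI: "p i \<in> ideal_power R I i" "q i \<in> ideal_power R I i" for i
      using pq by (auto simp: rees_carrier_def)
    have pqc: "p \<in> carrier (UP R)" "q \<in> carrier (UP R)" "p i \<in> carrier R" "q i \<in> carrier R" for i
      using pq ideal_power_carrier[OF I pqI(1)] ideal_power_carrier[OF I pqI(2)]
      by (auto simp: rees_carrier_def)
    show "leading_forms I (p \<otimes>\<^bsub>UP R\<^esub> q) = leading_forms I p \<otimes>\<^bsub>assoc_graded R I\<^esub> leading_forms I q"
    proof
      fix n
      interpret Q: ring_hom_cring R "R Quot ideal_power R I (Suc n)" "(+>) (ideal_power R I (Suc n))"
        by (rule ideal.rcos_ring_hom_cring[OF pI is_cring])
      have "(p \<otimes>\<^bsub>UP R\<^esub> q) n = (\<Oplus>i\<in>{..n}. p i \<otimes> q (n - i))"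
        using U.coeff_mult[of p q n] coeff pqc by simp
      then have "leading_forms I (p \<otimes>\<^bsub>UP R\<^esub> q) n =
          (\<Oplus>\<^bsub>R Quot ideal_power R I (Suc n)\<^esub>i\<in>{..n}. ideal_power R I (Suc n) +> (p i \<otimes> q (n - i)))"
        using pqc by (simp add: leading_forms_def Q.hom_finsum Pi_def comp_def)
      also have "\<dots> = (\<Oplus>\<^bsub>R Quot ideal_power R I (Suc n)\<^esub>i\<in>{..n}.
          rcoset_mult R (ideal_power R I (Suc n)) (leading_forms I p i) (leading_forms I q (n - i)))"
      proof -
        have eq: "rcoset_mult R (ideal_power R I (Suc n)) (leading_forms I p i) (leading_forms I q (n - i))
            = ideal_power R I (Suc n) +> (p i \<otimes> q (n - i))" if "i \<in> {..n}" for i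
          using that unfolding leading_forms_def by (intro graded_rcoset_mult I pqI) auto
        show ?thesis
          by (intro Q.S.finsum_cong') (use eq pqc Q.hom_closed in auto)
      qed
      finally show "leading_forms I (p \<otimes>\<^bsub>UP R\<^esub> q) n =
          (leading_forms I p \<otimes>\<^bsub>assoc_graded R I\<^esub> leading_forms I q) n"
        by (simp add: assoc_graded_def)
    qed
    have "(p \<oplus>\<^bsub>UP R\<^esub> q) n = p n \<oplus> q n" for n
      using U.coeff_add[of p q n] coeff pqc by simp
    then show "leading_forms I (p \<oplus>\<^bsub>UP R\<^esub> q) = leading_forms I p \<oplus>\<^bsub>assoc_graded R I\<^esub> leading_forms I q"
      using pqc abelian_subgroup.a_rcos_sum[OF abelian_subgroupI3[OF ideal.axioms(1)[OF pI] abelian_group_axioms]]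
      by (simp add: assoc_graded_def leading_forms_def)
  next
    show "leading_forms I \<one>\<^bsub>UP R\<^esub> = \<one>\<^bsub>assoc_graded R I\<^esub>"
      using U.coeff_one coeff[OF U.P.one_closed] rcos_zero[OF pI]
      by (auto simp: leading_forms_def assoc_graded_def fun_eq_iff)
  qed
qed

lemma leading_forms_surj:
  assumes I: "ideal I R"
  shows "leading_forms I ` rees_carrier I = carrier (assoc_graded R I)"
proof
  show "leading_forms I ` rees_carrier I \<subseteq> carrier (assoc_graded R I)"
    using ring_hom_memE(1)[OF leading_forms_hom[OF I]] by auto
  show "carrier (assoc_graded R I) \<subseteq> leading_forms I ` rees_carrier I"
  proof
    fix f assume f: "f \<in> carrier (assoc_graded R I)"
    note pI = ideal_power_ideal[OF I]
    \<comment> \<open>Zero components are lifted to \<open>\<zero>\<close>, since otherwise the lift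
      could have infinite support and fail to be a polynomial.\<close>
    have "\<exists>x\<in>ideal_power R I i. f i = ideal_power R I (Suc i) +> x \<and>
        (f i = ideal_power R I (Suc i) \<longrightarrow> x = \<zero>)" for i
      using f rcos_zero[OF pI] ideal_zero_mem[OF pI]
      by (cases "f i = ideal_power R I (Suc i)") (force simp: assoc_graded_def)+
    then obtain p where p: "\<And>i. p i \<in> ideal_power R I i"
      "\<And>i. f i = ideal_power R I (Suc i) +> p i"
      "\<And>i. f i = ideal_power R I (Suc i) \<Longrightarrow> p i = \<zero>"
      by metis
    have "finite {i. f i \<noteq> ideal_power R I (Suc i)}" using f by (simp add: assoc_graded_def)
    then obtain n where "\<forall>i\<in>{i. f i \<noteq> ideal_power R I (Suc i)}. i \<le> n"
      using finite_nat_set_iff_bounded_le by auto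
    then have "bound \<zero> n p" using p(3) by (force intro!: bound.intro)
    then have "p \<in> rees_carrier I"
      using p(1) ideal_power_carrier[OF I p(1)] by (auto simp: rees_carrier_def UP_def)
    moreover have "f = leading_forms I p" using p(2) by (simp add: leading_forms_def fun_eq_iff)
    ultimately show "f \<in> leading_forms I ` rees_carrier I" by blast
  qed
qed

lemma assoc_graded_ring:
  assumes I: "ideal I R"
  shows "ring (assoc_graded R I)"
proof -
  interpret U: UP_cring R "UP R" by unfold_locales
  have "leading_forms I \<zero>\<^bsub>UP R\<^esub> = \<zero>\<^bsub>assoc_graded R I\<^esub>"
    by (simp add: leading_forms_def assoc_graded_def UP_def rcos_zero[OF ideal_power_ideal[OF I]])
  then show ?thesis
    using ring.ring_hom_imp_img_ring[OF U.P.subring_is_ring[OF rees_subring[OF I]] leading_forms_hom[OF I]]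
    by (simp add: leading_forms_surj[OF I])
qed

text \<open>Let \<open>g\<close> be the form of \<open>w\<close> in degree \<open>k\<close>. A form
  of positive degree \<open>i\<close> lies in \<open>I\<close> times the power of exponent
  \<open>i - 1\<close>, so if \<open>I\<close> kills \<open>g\<close>, every element of the
  irrelevant ideal does. The first entry \<open>f\<close> of a regular sequence is such an element
  and a nonzerodivisor, which forces \<open>g\<close> to be zero.\<close>

lemma no_annihilator_of_depth:
  assumes I: "ideal I R"
    and depth: "depth (assoc_graded R I) (irrelevant_ideal R I) > 0"
    and w: "w \<in> ideal_power R I k"
    and ann: "\<And>x. x \<in> I \<Longrightarrow> x \<otimes> w \<in> ideal_power R I (Suc (Suc k))"
  shows "w \<in> ideal_power R I (Suc k)"
proof -
  note pI = ideal_power_ideal[OF I]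
  have wc: "w \<in> carrier R" using ideal_power_carrier[OF I w] .
  obtain xs where xs: "length xs > 0" "set xs \<subseteq> irrelevant_ideal R I"
    "regular_sequence (assoc_graded R I) xs"
    using depth by (force simp: depth_def less_Sup_iff zero_enat_def)
  define f where "f = xs ! 0"
  have f: "f \<in> carrier (assoc_graded R I)" "f 0 = ideal_power R I (Suc 0)"
  proof -
    have "f \<in> irrelevant_ideal R I" using xs(1,2) nth_mem[of 0 xs] by (auto simp: f_def)
    then show "f \<in> carrier (assoc_graded R I)" "f 0 = ideal_power R I (Suc 0)"
      unfolding irrelevant_ideal_def by (simp_all add: assoc_graded_def)
  qed
  interpret G: ring "assoc_graded R I" using assoc_graded_ring[OF I] .
  \<comment> \<open>Regularity of the first entry is stated modulo the ideal generated by the empty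
    set; this identifies it as zero.\<close>
  have Idl0: "Idl\<^bsub>assoc_graded R I\<^esub> {} = {\<zero>\<^bsub>assoc_graded R I\<^esub>}"
    using G.genideal_minimal[OF G.zeroideal, of "{}"]
      additive_subgroup.zero_closed[OF ideal.axioms(1)[OF G.genideal_ideal[of "{}"]]] by auto
  define g where "g i = (if i = k then ideal_power R I (Suc k) +> w else ideal_power R I (Suc i))" for i
  have "finite {i. g i \<noteq> ideal_power R I (Suc i)}"
    by (rule finite_subset[of _ "{k}"]) (auto simp: g_def)
  then have g: "g \<in> carrier (assoc_graded R I)"
    using w rcos_zero[OF pI] ideal_zero_mem[OF pI]
    by (auto simp: assoc_graded_def g_def intro: bexI[of _ \<zero>])
  have "(f \<otimes>\<^bsub>assoc_graded R I\<^esub> g) n = \<zero>\<^bsub>assoc_graded R I\<^esub> n" for n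
  proof -
    interpret Q: cring "R Quot ideal_power R I (Suc n)"
      by (rule ideal.quotient_is_cring[OF pI is_cring])
    have "rcoset_mult R (ideal_power R I (Suc n)) (f i) (g (n - i)) = ideal_power R I (Suc n)"
      if i: "i \<le> n" for i
    proof -
      \<comment> \<open>In degree 0 the representative can be chosen zero because \<open>f\<close>
        lies in the irrelevant ideal.\<close>
      obtain a where a: "a \<in> ideal_power R I i" "f i = ideal_power R I (Suc i) +> a"
        "i = 0 \<Longrightarrow> a = \<zero>"
      proof (cases "i = 0")
        case True
        then show ?thesis using that[of \<zero>] f(2) rcos_zero[OF pI] by simp
      next
        case False
        then show ?thesis using that f(1) by (auto simp: assoc_graded_def)
      qed
      have ac: "a \<in> carrier R" using ideal_power_carrier[OF I a(1)] .
      define b where "b = (if n - i = k then w else \<zero>)"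
      have b: "b \<in> ideal_power R I (n - i)" "g (n - i) = ideal_power R I (Suc (n - i)) +> b"
        using w rcos_zero[OF pI] ideal_zero_mem[OF pI] by (auto simp: b_def g_def)
      have "a \<otimes> b \<in> ideal_power R I (Suc n)"
      proof (cases "n - i = k \<and> i \<noteq> 0")
        case True
        then obtain m where m: "i = Suc m" using not0_implies_Suc by blast
        \<comment> \<open>One factor from \<open>I\<close> is split off the component of degree
          \<open>Suc m\<close> to meet \<open>ann\<close>; the colon ideal reduces this to
          products.\<close>
        have "ideal_power R I m \<cdot> I \<subseteq> {a \<in> carrier R. a \<otimes> w \<in> ideal_power R I (Suc n)}"
        proof (rule ideal_prod_subsetI[OF ideal_colon[OF pI wc]])
          fix c x assume c: "c \<in> ideal_power R I m" and x: "x \<in> I"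
          then have cx: "c \<in> carrier R" "x \<in> carrier R"
            using ideal_power_carrier[OF I] ideal.Icarr[OF I] by auto
          have "c \<otimes> (x \<otimes> w) \<in> ideal_power R I (Suc n)"
            using True m i by (intro ideal_power_mult[OF I c ann[OF x]]) auto
          then show "c \<otimes> x \<in> {a \<in> carrier R. a \<otimes> w \<in> ideal_power R I (Suc n)}"
            using cx wc by (simp add: m_assoc)
        qed
        then show ?thesis using a(1) True m by (auto simp: ideal_power_Suc[of _ m] b_def)
      next
        case False
        then show ?thesis
          using a(3) ac wc ideal_zero_mem[OF pI] by (auto simp: b_def)
      qed
      moreover have "b \<in> carrier R" using ideal_power_carrier[OF I b(1)] .
      ultimately show ?thesis
        unfolding a(2) b(2) using i ac graded_rcoset_mult[OF I a(1) b(1)] rcos_eq_self_iff[OF pI] by simp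
    qed
    then have "finsum (R Quot ideal_power R I (Suc n))
        (\<lambda>i. rcoset_mult R (ideal_power R I (Suc n)) (f i) (g (n - i))) {..n} =
      finsum (R Quot ideal_power R I (Suc n)) (\<lambda>i. \<zero>\<^bsub>R Quot ideal_power R I (Suc n)\<^esub>) {..n}"
      (is "?sum = _")
      by (intro Q.finsum_cong') (use Q.zero_closed in \<open>auto simp: FactRing_def\<close>)
    then have "?sum = ideal_power R I (Suc n)"
      using Q.finsum_zero[of "{..n}"] by (simp only: FactRing_def ring.simps)
    then show ?thesis by (simp add: assoc_graded_def)
  qed
  then have "f \<otimes>\<^bsub>assoc_graded R I\<^esub> g = \<zero>\<^bsub>assoc_graded R I\<^esub>" by auto
  then have "g \<in> Idl\<^bsub>assoc_graded R I\<^esub> {}"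
    using xs(1,3) g Idl0 unfolding regular_sequence_def f_def by force
  then have "g k = ideal_power R I (Suc k)" using Idl0 by (auto simp: assoc_graded_def)
  then show ?thesis using rcos_eq_self_iff[OF pI wc] by (simp add: g_def)
qed

end

subsection \<open>Module homomorphisms\<close>

lemma module_homI:
  assumes "\<And>x. x \<in> carrier M \<Longrightarrow> h x \<in> carrier N"
    and "\<And>x y. x \<in> carrier M \<Longrightarrow> y \<in> carrier M \<Longrightarrow> h (x \<oplus>\<^bsub>M\<^esub> y) = h x \<oplus>\<^bsub>N\<^esub> h y"
    and "\<And>a x. a \<in> carrier R \<Longrightarrow> x \<in> carrier M \<Longrightarrow> h (a \<odot>\<^bsub>M\<^esub> x) = a \<odot>\<^bsub>N\<^esub> h x"
  shows "h \<in> module_hom R M N"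
  using assms by (simp add: module_hom_def)

lemma module_homD:
  assumes "h \<in> module_hom R M N"
  shows "x \<in> carrier M \<Longrightarrow> h x \<in> carrier N"
    and "x \<in> carrier M \<Longrightarrow> y \<in> carrier M \<Longrightarrow> h (x \<oplus>\<^bsub>M\<^esub> y) = h x \<oplus>\<^bsub>N\<^esub> h y"
    and "a \<in> carrier R \<Longrightarrow> x \<in> carrier M \<Longrightarrow> h (a \<odot>\<^bsub>M\<^esub> x) = a \<odot>\<^bsub>N\<^esub> h x"
  using assms by (auto simp: module_hom_def)

lemma module_hom_zero:
  assumes "h \<in> module_hom R M N" "module R M" "module R N"
  shows "h \<zero>\<^bsub>M\<^esub> = \<zero>\<^bsub>N\<^esub>"
proof -
  interpret M: module R M by fact
  interpret N: module R N by fact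
  have "h (\<zero>\<^bsub>R\<^esub> \<odot>\<^bsub>M\<^esub> \<zero>\<^bsub>M\<^esub>) = \<zero>\<^bsub>R\<^esub> \<odot>\<^bsub>N\<^esub> h \<zero>\<^bsub>M\<^esub>"
    by (rule module_homD(3)[OF assms(1)]) simp_all
  then show ?thesis using module_homD(1)[OF assms(1)] by simp
qed

lemma module_hom_comp:
  assumes "g \<in> module_hom R M N" "h \<in> module_hom R N P"
  shows "h \<circ> g \<in> module_hom R M P"
  by (rule module_homI) (simp_all add: module_homD[OF assms(1)] module_homD[OF assms(2)])

lemma module_hom_inv:
  assumes "h \<in> module_hom R M N" "bij_betw h (carrier M) (carrier N)" "module R M"
  shows "the_inv_into (carrier M) h \<in> module_hom R N M"
proof -
  interpret M: module R M by fact
  note inj = bij_betw_imp_inj_on[OF assms(2)]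
  have ex: "\<exists>x\<in>carrier M. y = h x" if "y \<in> carrier N" for y
    using that bij_betw_imp_surj_on[OF assms(2)] by auto
  have inv: "the_inv_into (carrier M) h (h x) = x" if "x \<in> carrier M" for x
    using the_inv_into_f_f[OF inj that] .
  show ?thesis
  proof (rule module_homI)
    show "the_inv_into (carrier M) h x \<in> carrier M" if "x \<in> carrier N" for x
      using ex[OF that] inv by auto
    show "the_inv_into (carrier M) h (x \<oplus>\<^bsub>N\<^esub> y) =
        the_inv_into (carrier M) h x \<oplus>\<^bsub>M\<^esub> the_inv_into (carrier M) h y"
      if xy: "x \<in> carrier N" "y \<in> carrier N" for x y
    proof -
      obtain x' y' where "x' \<in> carrier M" "x = h x'" "y' \<in> carrier M" "y = h y'"
        using ex xy by metis
      then show ?thesis using inv[of "x' \<oplus>\<^bsub>M\<^esub> y'"] inv module_homD(2)[OF assms(1)] by simp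
    qed
    show "the_inv_into (carrier M) h (a \<odot>\<^bsub>N\<^esub> x) = a \<odot>\<^bsub>M\<^esub> the_inv_into (carrier M) h x"
      if ax: "a \<in> carrier R" "x \<in> carrier N" for a x
    proof -
      obtain x' where "x' \<in> carrier M" "x = h x'" using ex ax by metis
      then show ?thesis using inv[of "a \<odot>\<^bsub>M\<^esub> x'"] inv module_homD(3)[OF assms(1)] ax(1) by simp
    qed
  qed
qed

lemma module_iso_sym: "module_iso R M N \<Longrightarrow> module R M \<Longrightarrow> module_iso R N M"
  unfolding module_iso_def using module_hom_inv bij_betw_the_inv_into by blast

lemma module_iso_trans: "module_iso R M N \<Longrightarrow> module_iso R N P \<Longrightarrow> module_iso R M P"
  unfolding module_iso_def using module_hom_comp bij_betw_trans by blast

text \<open>The closure conditions see only modules with elements of type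
  \<open>(nat \<Rightarrow> 'a) set\<close>, while the exact sequences below have other element
  types; this carries the sequences over.\<close>

lemma short_exact_iso:
  assumes ex: "short_exact R L E N f g"
    and iso: "module_iso R L' L" "module_iso R E' E" "module_iso R N' N"
    and mods: "module R L'" "module R E'" "module R N'" "module R N"
  shows "\<exists>f' g'. short_exact R L' E' N' f' g'"
proof -
  obtain a where a: "a \<in> module_hom R L' L" "bij_betw a (carrier L') (carrier L)"
    using iso(1) by (auto simp: module_iso_def)
  obtain b where b: "b \<in> module_hom R E' E" "bij_betw b (carrier E') (carrier E)"
    using iso(2) by (auto simp: module_iso_def)
  obtain c where c: "c \<in> module_hom R N' N" "bij_betw c (carrier N') (carrier N)"
    using iso(3) by (auto simp: module_iso_def)
  define b' where "b' = the_inv_into (carrier E') b"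
  define c' where "c' = the_inv_into (carrier N') c"
  have b': "b' \<in> module_hom R E E'" "bij_betw b' (carrier E) (carrier E')"
    unfolding b'_def using module_hom_inv[OF b mods(2)] bij_betw_the_inv_into[OF b(2)] by auto
  have c': "c' \<in> module_hom R N N'" "bij_betw c' (carrier N) (carrier N')"
    unfolding c'_def using module_hom_inv[OF c mods(3)] bij_betw_the_inv_into[OF c(2)] by auto
  have b'b: "b' (b x) = x" if "x \<in> carrier E'" for x
    unfolding b'_def using the_inv_into_f_f[OF bij_betw_imp_inj_on[OF b(2)] that] .
  have bb': "b (b' x) = x" if "x \<in> carrier E" for x
    unfolding b'_def using f_the_inv_into_f_bij_betw[OF b(2)] that by blast
  have c0: "c' z = \<zero>\<^bsub>N'\<^esub> \<longleftrightarrow> z = \<zero>\<^bsub>N\<^esub>" if "z \<in> carrier N" for z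
    using module_hom_zero[OF c'(1) mods(4,3)] bij_betw_imp_inj_on[OF c'(2)] that
      abelian_monoid.zero_closed[of N] module.axioms(2)[OF mods(4)]
    by (metis abelian_group.axioms(1) inj_onD)
  have f: "f \<in> module_hom R L E" and g: "g \<in> module_hom R E N" and inj: "inj_on f (carrier L)"
    and im: "f ` carrier L = {x \<in> carrier E. g x = \<zero>\<^bsub>N\<^esub>}" and surj: "g ` carrier E = carrier N"
    using ex by (auto simp: short_exact_def)
  have aL: "a ` carrier L' = carrier L" using a(2) by (simp add: bij_betw_def)
  have "short_exact R L' E' N' (b' \<circ> f \<circ> a) (c' \<circ> g \<circ> b)"
    unfolding short_exact_def
  proof (intro conjI)
    show "b' \<circ> f \<circ> a \<in> module_hom R L' E'" "c' \<circ> g \<circ> b \<in> module_hom R E' N'"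
      using a(1) b(1) b'(1) c'(1) f g by (auto intro!: module_hom_comp)
    show "inj_on (b' \<circ> f \<circ> a) (carrier L')"
      using a(2) inj b'(2) im
      by (intro comp_inj_on) (auto simp: bij_betw_def intro: inj_on_subset)
    show "(c' \<circ> g \<circ> b) ` carrier E' = carrier N'"
      using b(2) surj c'(2) by (simp only: image_comp[symmetric] bij_betw_def)
    have "(b' \<circ> f \<circ> a) ` carrier L' = b' ` {x \<in> carrier E. g x = \<zero>\<^bsub>N\<^esub>}"
      using aL im by (simp only: image_comp[symmetric])
    also have "\<dots> = {x \<in> carrier E'. g (b x) = \<zero>\<^bsub>N\<^esub>}"
      using module_homD(1)[OF b'(1)] module_homD(1)[OF b(1)] bb' b'b by force
    also have "\<dots> = {x \<in> carrier E'. (c' \<circ> g \<circ> b) x = \<zero>\<^bsub>N'\<^esub>}"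
      using c0 module_homD(1)[OF b(1)] module_homD(1)[OF g] by auto
    finally show "(b' \<circ> f \<circ> a) ` carrier L' = {x \<in> carrier E'. (c' \<circ> g \<circ> b) x = \<zero>\<^bsub>N'\<^esub>}" .
  qed
  then show ?thesis by blast
qed

lemma submodule_vimage:
  assumes "h \<in> module_hom R M N" "module R M" "module R N" "submodule H R N"
  shows "submodule {x \<in> carrier M. h x \<in> H} R M"
proof -
  interpret M: module R M by fact
  interpret N: module R N by fact
  note H = N.submoduleE[OF assms(4)]
  have H0: "\<zero>\<^bsub>N\<^esub> \<in> H" using H(2) H(4)[of "\<zero>\<^bsub>R\<^esub>"] H(1) by fastforce
  show ?thesis
  proof (rule M.submoduleI)
    show "\<zero>\<^bsub>M\<^esub> \<in> {x \<in> carrier M. h x \<in> H}"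
      using module_hom_zero[OF assms(1-3)] H0 by simp
    show "\<ominus>\<^bsub>M\<^esub> x \<in> {x \<in> carrier M. h x \<in> H}" if "x \<in> {x \<in> carrier M. h x \<in> H}" for x
    proof -
      have "h (\<ominus>\<^bsub>R\<^esub> \<one>\<^bsub>R\<^esub> \<odot>\<^bsub>M\<^esub> x) \<in> H"
        using that H(4) module_homD(3)[OF assms(1)] by simp
      then show ?thesis using that by (simp add: M.smult_l_minus)
    qed
  qed (use module_homD[OF assms(1)] H in auto)
qed

lemma fin_gen_module_iso:
  assumes "fin_gen_module R M" "module_iso R M N" "module R N"
  shows "fin_gen_module R N"
proof -
  obtain h where h: "h \<in> module_hom R M N" "bij_betw h (carrier M) (carrier N)"
    using assms(2) by (auto simp: module_iso_def)
  obtain S where S: "finite S" "S \<subseteq> carrier M" "module R M"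
    "\<And>H. submodule H R M \<Longrightarrow> S \<subseteq> H \<Longrightarrow> H = carrier M"
    using assms(1) by (auto simp: fin_gen_module_def)
  have "H = carrier N" if H: "submodule H R N" "h ` S \<subseteq> H" for H
  proof
    show "H \<subseteq> carrier N" using module.submoduleE(1)[OF assms(3) H(1)] .
    have "{x \<in> carrier M. h x \<in> H} = carrier M"
      using S(2) H(2) by (intro S(4) submodule_vimage[OF h(1) S(3) assms(3) H(1)]) auto
    then show "carrier N \<subseteq> H" using bij_betw_imp_surj_on[OF h(2), symmetric] by auto
  qed
  then show ?thesis
    using S(1,2) assms(3) module_homD(1)[OF h(1)] unfolding fin_gen_module_def
    by (intro conjI exI[of _ "h ` S"]) auto
qed

section \<open>Copies of modules in \<open>mod_cat\<close>\<close>

definition transport_module :: "('b \<Rightarrow> 'c) \<Rightarrow> ('a, 'b, 'm) module_scheme \<Rightarrow> ('a, 'c) module" where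
  "transport_module i M =
     \<lparr>carrier = i ` carrier M, monoid.mult = undefined, one = undefined, ring.zero = i \<zero>\<^bsub>M\<^esub>,
      add = (\<lambda>x y. i (the_inv_into (carrier M) i x \<oplus>\<^bsub>M\<^esub> the_inv_into (carrier M) i y)),
      smult = (\<lambda>a x. i (a \<odot>\<^bsub>M\<^esub> the_inv_into (carrier M) i x))\<rparr>"

lemma transport_module:
  assumes "module R M" "inj_on i (carrier M)"
  shows "module R (transport_module i M)" "module_iso R M (transport_module i M)"
proof -
  interpret M: module R M by fact
  have inv: "the_inv_into (carrier M) i (i x) = x" if "x \<in> carrier M" for x
    using the_inv_into_f_f[OF assms(2) that] .
  have neg: "\<exists>y\<in>carrier M. i (y \<oplus>\<^bsub>M\<^esub> x) = i \<zero>\<^bsub>M\<^esub>" if "x \<in> carrier M" for x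
    using that by (intro bexI[of _ "\<ominus>\<^bsub>M\<^esub> x"]) (simp_all add: M.M.l_neg)
  show "module R (transport_module i M)"
  proof (rule moduleI[OF M.is_cring])
    show "abelian_group (transport_module i M)"
      by (rule abelian_groupI)
        (use neg in \<open>auto simp: transport_module_def inv M.M.a_assoc, simp add: M.M.a_comm\<close>)
  qed (auto simp: transport_module_def inv M.smult_l_distr M.smult_r_distr M.smult_assoc1)
  have "i \<in> module_hom R M (transport_module i M)"
    by (rule module_homI) (auto simp: transport_module_def inv)
  moreover have "bij_betw i (carrier M) (carrier (transport_module i M))"
    using assms(2) by (simp add: bij_betw_def transport_module_def)
  ultimately show "module_iso R M (transport_module i M)"
    by (auto simp: module_iso_def)
qed

text \<open>Finite generation would give the surjection \<open>p\<close>; in all cases below it is at hand.\<close>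

lemma mod_cat_representative:
  fixes R :: "('a, 'r) ring_scheme" and p :: "(nat \<Rightarrow> 'a) \<Rightarrow> 'b"
  assumes "fin_gen_module R M" "carrier M \<subseteq> range p"
  shows "\<exists>X\<in>mod_cat R. module_iso R X M"
proof -
  have M: "module R M" using assms(1) by (simp add: fin_gen_module_def)
  \<comment> \<open>An element is replaced by its fibre under \<open>p\<close>, a set of sequences
    and so of the required type. Fibres of distinct elements differ because they are disjoint and
    nonempty.\<close>
  have inj: "inj_on (\<lambda>z. p -` {z}) (carrier M)"
    using assms(2) by (intro inj_onI) blast
  note T = transport_module[OF M inj]
  show ?thesis
    using fin_gen_module_iso[OF assms(1) T(2,1)] module_iso_sym[OF T(2) M]
    by (auto simp: mod_cat_def)
qed

lemma module_of_mod_cat: "X \<in> mod_cat R \<Longrightarrow> module R X"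
  by (simp add: mod_cat_def fin_gen_module_def)


subsection \<open>Closure properties of modules built from a module\<close>

lemma ext_cat_mod_cat:
  assumes "X \<in> ext_cat R M" shows "X \<in> mod_cat R"
proof -
  have "mod_cat R \<in> {\<X>. strict_subcat R \<X> \<and> closed_summands R \<X> \<and> closed_extensions R \<X> \<and>
      {X \<in> mod_cat R. module_iso R X M} \<subseteq> \<X>}"
    by (auto simp: strict_subcat_def closed_summands_def closed_extensions_def)
  then show ?thesis using assms unfolding ext_cat_def by blast
qed

lemma ext_cat_summand:
  assumes "X \<in> ext_cat R M" "Y \<in> mod_cat R" "Z \<in> mod_cat R" "module_iso R (direct_sum Y Z) X"
  shows "Y \<in> ext_cat R M"
  using assms unfolding ext_cat_def closed_summands_def by blast

lemma ext_cat_extension: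
  assumes "L \<in> ext_cat R M" "N \<in> ext_cat R M" "E \<in> mod_cat R" "short_exact R L E N f g"
  shows "E \<in> ext_cat R M"
  using assms unfolding ext_cat_def closed_extensions_def by blast

lemma built_from_iso: "built_from R M N \<Longrightarrow> module_iso R N P \<Longrightarrow> built_from R M P"
  unfolding built_from_def using module_iso_trans by blast

lemma built_from_self:
  assumes "X \<in> mod_cat R" "module_iso R X M"
  shows "built_from R M M"
  using assms unfolding built_from_def ext_cat_def by blast

lemma built_from_extension:
  assumes "built_from R M L" "built_from R M N" "short_exact R L E N f g"
    and "X \<in> mod_cat R" "module_iso R X E" "module R N"
  shows "built_from R M E"
proof -
  obtain L' N' where *: "L' \<in> ext_cat R M" "module_iso R L' L" "N' \<in> ext_cat R M" "module_iso R N' N"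
    using assms(1,2) by (auto simp: built_from_def)
  then have "\<exists>f' g'. short_exact R L' X N' f' g'"
    using assms(4-6) ext_cat_mod_cat module_of_mod_cat by (intro short_exact_iso[OF assms(3)]) blast+
  then show ?thesis
    using ext_cat_extension[OF *(1,3) assms(4)] assms(5) by (auto simp: built_from_def)
qed

lemma direct_sum_module:
  assumes "module R M" "module R N"
  shows "module R (direct_sum M N)"
proof -
  interpret M: module R M by fact
  interpret N: module R N by fact
  have neg: "\<exists>x'\<in>carrier M. \<exists>y'\<in>carrier N. x' \<oplus>\<^bsub>M\<^esub> x = \<zero>\<^bsub>M\<^esub> \<and> y' \<oplus>\<^bsub>N\<^esub> y = \<zero>\<^bsub>N\<^esub>"
    if "x \<in> carrier M" "y \<in> carrier N" for x y
    using that by (intro bexI[of _ "\<ominus>\<^bsub>M\<^esub> x"] bexI[of _ "\<ominus>\<^bsub>N\<^esub> y"]) (simp_all add: M.M.l_neg N.M.l_neg)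
  show ?thesis
  proof (rule moduleI[OF M.is_cring])
    show "abelian_group (direct_sum M N)"
      by (rule abelian_groupI) (auto simp: direct_sum_def M.M.a_ac N.M.a_ac neg)
  qed (auto simp: direct_sum_def M.smult_l_distr M.smult_r_distr M.smult_assoc1
      N.smult_l_distr N.smult_r_distr N.smult_assoc1)
qed

lemma direct_sum_iso:
  assumes "module_iso R M M'" "module_iso R N N'"
  shows "module_iso R (direct_sum M N) (direct_sum M' N')"
proof -
  obtain a b where a: "a \<in> module_hom R M M'" "bij_betw a (carrier M) (carrier M')"
    and b: "b \<in> module_hom R N N'" "bij_betw b (carrier N) (carrier N')"
    using assms by (auto simp: module_iso_def)
  have "map_prod a b \<in> module_hom R (direct_sum M N) (direct_sum M' N')"
    by (rule module_homI) (auto simp: direct_sum_def module_homD[OF a(1)] module_homD[OF b(1)])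
  moreover have "bij_betw (map_prod a b) (carrier (direct_sum M N)) (carrier (direct_sum M' N'))"
    using a(2) b(2) by (simp add: direct_sum_def bij_betw_map_prod)
  ultimately show ?thesis by (auto simp: module_iso_def)
qed

lemma fin_gen_direct_sum:
  assumes "fin_gen_module R M" "fin_gen_module R N"
  shows "fin_gen_module R (direct_sum M N)"
proof -
  have M: "module R M" and N: "module R N" using assms by (auto simp: fin_gen_module_def)
  interpret M: module R M by fact
  interpret N: module R N by fact
  have DS: "module R (direct_sum M N)" by (rule direct_sum_module[OF M N])
  obtain S where S: "finite S" "S \<subseteq> carrier M" "\<And>H. submodule H R M \<Longrightarrow> S \<subseteq> H \<Longrightarrow> H = carrier M"
    using assms(1) by (auto simp: fin_gen_module_def)
  obtain T where T: "finite T" "T \<subseteq> carrier N" "\<And>H. submodule H R N \<Longrightarrow> T \<subseteq> H \<Longrightarrow> H = carrier N"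
    using assms(2) by (auto simp: fin_gen_module_def)
  define U where "U = (\<lambda>x. (x, \<zero>\<^bsub>N\<^esub>)) ` S \<union> (\<lambda>y. (\<zero>\<^bsub>M\<^esub>, y)) ` T"
  have homs: "(\<lambda>x. (x, \<zero>\<^bsub>N\<^esub>)) \<in> module_hom R M (direct_sum M N)"
    "(\<lambda>y. (\<zero>\<^bsub>M\<^esub>, y)) \<in> module_hom R N (direct_sum M N)"
    by (rule module_homI; simp add: direct_sum_def)+
  have "H = carrier (direct_sum M N)" if H: "submodule H R (direct_sum M N)" "U \<subseteq> H" for H
  proof
    note HE = module.submoduleE[OF DS H(1)]
    show "H \<subseteq> carrier (direct_sum M N)" by (rule HE(1))
    have 1: "{x \<in> carrier M. (x, \<zero>\<^bsub>N\<^esub>) \<in> H} = carrier M"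
      using S(2) H(2) by (intro S(3) submodule_vimage[OF homs(1) M DS H(1)]) (auto simp: U_def)
    have 2: "{y \<in> carrier N. (\<zero>\<^bsub>M\<^esub>, y) \<in> H} = carrier N"
      using T(2) H(2) by (intro T(3) submodule_vimage[OF homs(2) N DS H(1)]) (auto simp: U_def)
    show "carrier (direct_sum M N) \<subseteq> H"
    proof
      fix z assume "z \<in> carrier (direct_sum M N)"
      then obtain x y where z: "z = (x, y)" "x \<in> carrier M" "y \<in> carrier N"
        by (auto simp: direct_sum_def)
      then have "(x, \<zero>\<^bsub>N\<^esub>) \<oplus>\<^bsub>direct_sum M N\<^esub> (\<zero>\<^bsub>M\<^esub>, y) \<in> H"
        using 1 2 by (intro HE(5)) auto
      then show "z \<in> H" using z by (simp add: direct_sum_def)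
    qed
  qed
  then show ?thesis
    using DS S(1,2) T(1,2) unfolding fin_gen_module_def
    by (intro conjI exI[of _ U]) (auto simp: U_def direct_sum_def)
qed

lemma built_from_summand:
  assumes "built_from R M (direct_sum Y Z)"
    and "Y' \<in> mod_cat R" "module_iso R Y' Y" "Z' \<in> mod_cat R" "module_iso R Z' Z"
  shows "built_from R M Y"
proof -
  obtain X where X: "X \<in> ext_cat R M" "module_iso R X (direct_sum Y Z)"
    using assms(1) by (auto simp: built_from_def)
  have "module_iso R (direct_sum Y' Z') X"
    using direct_sum_iso[OF assms(3,5)] module_iso_sym[OF X(2) module_of_mod_cat[OF ext_cat_mod_cat[OF X(1)]]]
    by (rule module_iso_trans)
  then show ?thesis
    using ext_cat_summand[OF X(1) assms(2,4)] assms(3) by (auto simp: built_from_def)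
qed

text \<open>Adding a zero module to any object \<open>X\<close> gives a module isomorphic to
  \<open>X\<close>, so zero is a summand of it; \<open>L\<close> is there to supply an object. This
  starts the induction along a composition series.\<close>

lemma built_from_zero:
  assumes "built_from R M L" "module R Z" "carrier Z = {\<zero>\<^bsub>Z\<^esub>}"
  shows "built_from R M Z"
proof -
  interpret Z: module R Z by fact
  obtain X where X: "X \<in> ext_cat R M" using assms(1) by (auto simp: built_from_def)
  interpret X: module R X using module_of_mod_cat[OF ext_cat_mod_cat[OF X]] .
  have "fin_gen_module R Z"
    unfolding fin_gen_module_def using assms(2,3)
    by (intro conjI exI[of _ "{\<zero>\<^bsub>Z\<^esub>}"]) (auto dest: Z.submoduleE(1))
  then obtain Z' where Z': "Z' \<in> mod_cat R" "module_iso R Z' Z"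
    using mod_cat_representative[of R Z "\<lambda>_. \<zero>\<^bsub>Z\<^esub>"] assms(3) by auto
  interpret Z': module R Z' using module_of_mod_cat[OF Z'(1)] .
  have "\<exists>z. carrier Z' = {z}"
  proof -
    obtain h where "inj_on h (carrier Z')" "h ` carrier Z' = {\<zero>\<^bsub>Z\<^esub>}"
      using Z'(2) assms(3) by (auto simp: module_iso_def bij_betw_def)
    then have "x = y" if "x \<in> carrier Z'" "y \<in> carrier Z'" for x y
      using that by (metis inj_onD imageI singletonD)
    then show ?thesis using Z'.M.zero_closed by blast
  qed
  then have zero: "carrier Z' = {\<zero>\<^bsub>Z'\<^esub>}" using Z'.M.zero_closed by auto
  have "snd \<in> module_hom R (direct_sum Z' X) X"
    by (rule module_homI) (auto simp: direct_sum_def)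
  moreover have "bij_betw snd (carrier (direct_sum Z' X)) (carrier X)"
    unfolding direct_sum_def zero by (auto simp: bij_betw_def inj_on_def)
  ultimately have "module_iso R (direct_sum Z' X) X" by (auto simp: module_iso_def)
  then have "Z' \<in> ext_cat R M"
    using ext_cat_summand[OF X Z'(1) ext_cat_mod_cat[OF X]] by simp
  then show ?thesis using Z'(2) by (auto simp: built_from_def)
qed

subsection \<open>Cyclic modules\<close>

context cring
begin

lemma quotient_module_carrier: "carrier (quotient_module R I) = (\<lambda>a. I +> a) ` carrier R"
  by (auto simp: quotient_module_def ring.defs module.defs FactRing_def A_RCOSETS_def')

lemma quotient_module_zero: "\<zero>\<^bsub>quotient_module R I\<^esub> = I"
  by (simp add: quotient_module_def ring.defs module.defs FactRing_def)

lemma quotient_module_add: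
  assumes "ideal I R" "a \<in> carrier R" "b \<in> carrier R"
  shows "(I +> a) \<oplus>\<^bsub>quotient_module R I\<^esub> (I +> b) = I +> (a \<oplus> b)"
  using assms abelian_subgroup.a_rcos_sum[OF abelian_subgroupI3[OF ideal.axioms(1) abelian_group_axioms]]
  by (simp add: quotient_module_def ring.defs module.defs FactRing_def)

lemma quotient_module_smult:
  assumes "ideal I R" "a \<in> carrier R" "b \<in> carrier R"
  shows "a \<odot>\<^bsub>quotient_module R I\<^esub> (I +> b) = I +> (a \<otimes> b)"
  using assms ideal.rcoset_mult_add[OF assms(1)]
  by (simp add: quotient_module_def ring.defs module.defs FactRing_def)

lemmas quotient_module_ops = quotient_module_add quotient_module_smult

lemma quotient_module_module:
  assumes I: "ideal I R"
  shows "module R (quotient_module R I)"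
proof (rule moduleI[OF is_cring])
  have neg: "\<exists>b\<in>carrier R. I +> (a \<oplus> b) = I" if "a \<in> carrier R" for a
    using that rcos_zero[OF I] by (intro bexI[of _ "\<ominus> a"]) (simp_all add: r_neg)
  show "abelian_group (quotient_module R I)"
  proof (rule abelian_groupI)
    show "\<zero>\<^bsub>quotient_module R I\<^esub> \<in> carrier (quotient_module R I)"
      unfolding quotient_module_carrier quotient_module_zero using rcos_zero[OF I] by force
    show "\<zero>\<^bsub>quotient_module R I\<^esub> \<oplus>\<^bsub>quotient_module R I\<^esub> x = x"
      if "x \<in> carrier (quotient_module R I)" for x
      using that quotient_module_add[OF I zero_closed] rcos_zero[OF I]
      by (auto simp: quotient_module_carrier quotient_module_zero)
  qed (auto simp: quotient_module_carrier quotient_module_zero quotient_module_add[OF I] a_ac neg)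
qed (auto simp: quotient_module_carrier quotient_module_ops[OF I] l_distr r_distr m_assoc)

lemma fin_gen_quotient_module:
  assumes I: "ideal I R"
  shows "fin_gen_module R (quotient_module R I)"
proof -
  note Q = quotient_module_module[OF I]
  have "H = carrier (quotient_module R I)"
    if H: "submodule H R (quotient_module R I)" "{I +> \<one>} \<subseteq> H" for H
  proof
    note HE = module.submoduleE[OF Q H(1)]
    show "H \<subseteq> carrier (quotient_module R I)" by (rule HE(1))
    have "I +> a \<in> H" if "a \<in> carrier R" for a
      using HE(4)[OF that, of "I +> \<one>"] H(2) that by (simp add: quotient_module_smult[OF I])
    then show "carrier (quotient_module R I) \<subseteq> H" by (auto simp: quotient_module_carrier)
  qed
  then show ?thesis
    using Q unfolding fin_gen_module_def
    by (intro conjI exI[of _ "{I +> \<one>}"]) (auto simp: quotient_module_carrier)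
qed

lemma quotient_module_representative:
  assumes I: "ideal I R"
  shows "\<exists>X\<in>mod_cat R. module_iso R X (quotient_module R I)"
  by (rule mod_cat_representative[OF fin_gen_quotient_module[OF I], of "\<lambda>v. I +> v 0"])
    (auto simp: quotient_module_carrier intro: image_eqI[of _ _ "\<lambda>_. x" for x])

lemma quotient_module_hom:
  assumes I: "ideal I R" and J: "ideal J R" and c: "c \<in> carrier R"
    and IJ: "\<And>a. a \<in> I \<Longrightarrow> c \<otimes> a \<in> J"
  obtains h where "h \<in> module_hom R (quotient_module R I) (quotient_module R J)"
    and "\<And>a. a \<in> carrier R \<Longrightarrow> h (I +> a) = J +> (c \<otimes> a)"
proof -
  define h where "h Y = J +> (c \<otimes> (SOME a. a \<in> carrier R \<and> Y = I +> a))" for Y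
  have h: "h (I +> a) = J +> (c \<otimes> a)" if a: "a \<in> carrier R" for a
  proof -
    define b where "b = (SOME b. b \<in> carrier R \<and> I +> a = I +> b)"
    have b: "b \<in> carrier R" "I +> a = I +> b"
      using someI[of "\<lambda>b. b \<in> carrier R \<and> I +> a = I +> b" a] a by (auto simp: b_def)
    then have "c \<otimes> (b \<ominus> a) \<in> J" using IJ rcos_eq_iff[OF I b(1) a] by simp
    moreover have "c \<otimes> (b \<ominus> a) = c \<otimes> b \<ominus> c \<otimes> a"
      using c a b(1) by algebra
    ultimately show ?thesis
      unfolding h_def b_def[symmetric] using rcos_eq_iff[OF J] a b(1) c by simp
  qed
  show ?thesis
  proof (rule that)
    show "h \<in> module_hom R (quotient_module R I) (quotient_module R J)"
      by (rule module_homI)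
        (use c in \<open>auto simp: quotient_module_carrier quotient_module_ops[OF I] quotient_module_ops[OF J]
          h r_distr m_lcomm\<close>)
  qed (rule h)
qed

text \<open>Multiplication by \<open>x\<close> maps the square formed by the projections
  \<open>R/P \<rightarrow> R/J\<close> and \<open>R/K \<rightarrow> R/P\<close>. It induces a map
  between their kernels, \<open>J/P \<rightarrow> P/K\<close>; \<open>inj\<close> and
  \<open>span\<close> say that this map is injective and surjective, and then the square is both a
  pullback and a pushout. The exact sequence is the one attached to such a square. In the
  application \<open>P\<close>, \<open>J\<close> are consecutive powers of the maximal
  ideal.\<close>

lemma quotient_sum_short_exact:
  assumes P: "ideal P R" and J: "ideal J R" and K: "ideal K R" and x: "x \<in> carrier R"
    and KP: "K \<subseteq> P" and PJ: "P \<subseteq> J"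
    and xP: "\<And>a. a \<in> P \<Longrightarrow> x \<otimes> a \<in> K" and xJ: "\<And>a. a \<in> J \<Longrightarrow> x \<otimes> a \<in> P"
    and inj: "\<And>a. a \<in> J \<Longrightarrow> x \<otimes> a \<in> K \<Longrightarrow> a \<in> P"
    and span: "\<And>p. p \<in> P \<Longrightarrow> \<exists>u\<in>J. \<exists>c\<in>K. p = x \<otimes> u \<oplus> c"
  shows "\<exists>f g. short_exact R (quotient_module R P)
    (direct_sum (quotient_module R J) (quotient_module R K)) (quotient_module R P) f g"
proof -
  obtain f1 where f1: "f1 \<in> module_hom R (quotient_module R P) (quotient_module R J)"
    "\<And>a. a \<in> carrier R \<Longrightarrow> f1 (P +> a) = J +> (\<one> \<otimes> a)"
    using quotient_module_hom[OF P J one_closed] PJ ideal.Icarr[OF P] by auto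
  obtain f2 where f2: "f2 \<in> module_hom R (quotient_module R P) (quotient_module R K)"
    "\<And>a. a \<in> carrier R \<Longrightarrow> f2 (P +> a) = K +> (x \<otimes> a)"
    using quotient_module_hom[OF P K x] xP by auto
  obtain g1 where g1: "g1 \<in> module_hom R (quotient_module R J) (quotient_module R P)"
    "\<And>a. a \<in> carrier R \<Longrightarrow> g1 (J +> a) = P +> ((\<ominus> x) \<otimes> a)"
    using quotient_module_hom[OF J P, of "\<ominus> x"] x xJ ideal.Icarr[OF J]
    by (auto simp: l_minus ideal_neg_mem[OF P])
  obtain g2 where g2: "g2 \<in> module_hom R (quotient_module R K) (quotient_module R P)"
    "\<And>a. a \<in> carrier R \<Longrightarrow> g2 (K +> a) = P +> (\<one> \<otimes> a)"
    using quotient_module_hom[OF K P one_closed] KP ideal.Icarr[OF K] by auto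
  interpret QP: module R "quotient_module R P" by (rule quotient_module_module[OF P])
  let ?E = "direct_sum (quotient_module R J) (quotient_module R K)"
  define f where "f Y = (f1 Y, f2 Y)" for Y
  define g where "g = (\<lambda>(Y, Z). g1 Y \<oplus>\<^bsub>quotient_module R P\<^esub> g2 Z)"
  have f: "f (P +> a) = (J +> a, K +> (x \<otimes> a))" if "a \<in> carrier R" for a
    using that f1 f2 by (simp add: f_def)
  have g: "g (J +> t, K +> r) = P +> (r \<ominus> x \<otimes> t)" if "t \<in> carrier R" "r \<in> carrier R" for t r
  proof -
    have "(\<ominus> x) \<otimes> t \<oplus> r = r \<ominus> x \<otimes> t" using that x by algebra
    then show ?thesis
      using that x g1(2) g2(2) by (simp add: g_def quotient_module_add[OF P])
  qed
  have carE: "carrier ?E = {(J +> t, K +> r) | t r. t \<in> carrier R \<and> r \<in> carrier R}"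
    by (auto simp: direct_sum_def quotient_module_carrier)
  have "short_exact R (quotient_module R P) ?E (quotient_module R P) f g"
    unfolding short_exact_def
  proof (intro conjI)
    show "f \<in> module_hom R (quotient_module R P) ?E"
      by (rule module_homI)
        (auto simp: f_def direct_sum_def module_homD[OF f1(1)] module_homD[OF f2(1)])
    show "g \<in> module_hom R ?E (quotient_module R P)"
      by (rule module_homI)
        (auto simp: g_def direct_sum_def module_homD[OF g1(1)] module_homD[OF g2(1)] QP.smult_r_distr
          QP.M.a_ac)
    show "inj_on f (carrier (quotient_module R P))"
    proof (rule inj_onI)
      fix Y Z assume "Y \<in> carrier (quotient_module R P)" "Z \<in> carrier (quotient_module R P)" and eq: "f Y = f Z"
      then obtain a b where ab: "a \<in> carrier R" "Y = P +> a" "b \<in> carrier R" "Z = P +> b"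
        by (auto simp: quotient_module_carrier)
      then have "a \<ominus> b \<in> J" "x \<otimes> a \<ominus> x \<otimes> b \<in> K"
        using eq f rcos_eq_iff[OF J, of a b] rcos_eq_iff[OF K, of "x \<otimes> a" "x \<otimes> b"] x by auto
      moreover have "x \<otimes> a \<ominus> x \<otimes> b = x \<otimes> (a \<ominus> b)" using ab x by algebra
      ultimately have "a \<ominus> b \<in> P" using inj by simp
      then show "Y = Z" using ab rcos_eq_iff[OF P] by simp
    qed
    show "g ` carrier ?E = carrier (quotient_module R P)"
    proof
      show "g ` carrier ?E \<subseteq> carrier (quotient_module R P)"
        using g x by (auto simp: carE quotient_module_carrier)
      have "P +> a = g (J +> \<zero>, K +> a)" if "a \<in> carrier R" for a
        using g[OF zero_closed that] that x by (simp add: minus_eq)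
      then show "carrier (quotient_module R P) \<subseteq> g ` carrier ?E"
        by (auto simp: carE quotient_module_carrier)
    qed
    show "f ` carrier (quotient_module R P) = {y \<in> carrier ?E. g y = \<zero>\<^bsub>quotient_module R P\<^esub>}"
    proof
      have "g (f (P +> a)) = P" if "a \<in> carrier R" for a
        using that f g[of a "x \<otimes> a"] x rcos_zero[OF P] by (simp add: minus_eq r_neg)
      moreover have "f (P +> a) \<in> carrier ?E" if "a \<in> carrier R" for a
        unfolding f[OF that] carE using that x by blast
      ultimately show "f ` carrier (quotient_module R P) \<subseteq> {y \<in> carrier ?E. g y = \<zero>\<^bsub>quotient_module R P\<^esub>}"
        by (auto simp: quotient_module_carrier quotient_module_zero)
      show "{y \<in> carrier ?E. g y = \<zero>\<^bsub>quotient_module R P\<^esub>} \<subseteq> f ` carrier (quotient_module R P)"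
      proof
        fix y assume "y \<in> {y \<in> carrier ?E. g y = \<zero>\<^bsub>quotient_module R P\<^esub>}"
        then obtain t r where y: "y = (J +> t, K +> r)" and tr: "t \<in> carrier R" "r \<in> carrier R"
          and "g y = P" by (auto simp: carE quotient_module_zero)
        then have "r \<ominus> x \<otimes> t \<in> P"
          using g x rcos_eq_self_iff[OF P] by simp
        \<comment> \<open>The preimage is the class of \<open>t \<oplus> u\<close>: it differs from
          \<open>t\<close> by \<open>u\<close> in \<open>J\<close>, and \<open>x\<close> times it
          differs from \<open>r\<close> by \<open>c\<close> in \<open>K\<close>, up to sign.\<close>
        then obtain u c where u: "u \<in> J" and c: "c \<in> K" and ruc: "r \<ominus> x \<otimes> t = x \<otimes> u \<oplus> c"
          using span by blast
        have uc: "u \<in> carrier R" "c \<in> carrier R"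
          using u c ideal.Icarr[OF J] ideal.Icarr[OF K] by auto
        have "t \<oplus> u \<ominus> t = u" using tr uc by algebra
        then have "J +> (t \<oplus> u) = J +> t" using rcos_eq_iff[OF J] u uc tr by simp
        moreover have "K +> (x \<otimes> (t \<oplus> u)) = K +> r"
        proof -
          have "x \<otimes> (t \<oplus> u) \<ominus> r = x \<otimes> u \<ominus> (r \<ominus> x \<otimes> t)" using tr uc x by algebra
          also have "\<dots> = \<ominus> c" unfolding ruc using uc x by algebra
          finally show ?thesis using rcos_eq_iff[OF K] c ideal_neg_mem[OF K] uc tr x by simp
        qed
        ultimately have "y = f (P +> (t \<oplus> u))" using f tr uc y by simp
        then show "y \<in> f ` carrier (quotient_module R P)"
          using tr uc by (auto simp: quotient_module_carrier)
      qed
    qed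
  qed
  then show ?thesis by blast
qed

section \<open>The descent from a power of the maximal ideal to the preceding one\<close>

lemma noetherian_maximal_ideal_exists:
  assumes "noetherian_ring R" "F \<noteq> {}" "\<And>I. I \<in> F \<Longrightarrow> ideal I R"
  shows "\<exists>K\<in>F. \<forall>I\<in>F. K \<subseteq> I \<longrightarrow> I = K"
proof (rule subset_Zorn_nonempty[OF assms(2)])
  fix C assume C: "C \<noteq> {}" "subset.chain F C"
  then have "subset.chain {I. ideal I R} C" and "C \<subseteq> F"
    using assms(3) by (auto simp: subset.chain_def)
  then show "\<Union>C \<in> F"
    using noetherian_ring.ideal_chain_is_trivial[OF assms(1) C(1)] by blast
qed

lemma local_ring_Units:
  assumes noeth: "noetherian_ring R" and loc: "local_ring R \<mm>"
    and r: "r \<in> carrier R" "r \<notin> \<mm>"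
  shows "r \<in> Units R"
proof (rule ccontr)
  assume nu: "r \<notin> Units R"
  define F where "F = {I. ideal I R \<and> r \<in> I \<and> \<one> \<notin> I}"
  have "\<one> \<notin> PIdl r"
  proof
    assume "\<one> \<in> PIdl r"
    then obtain s where "s \<in> carrier R" "\<one> = s \<otimes> r" by (auto simp: cgenideal_def)
    then have "r \<in> Units R" using r(1) m_comm[of s r] unfolding Units_def by auto
    then show False using nu by simp
  qed
  then have "PIdl r \<in> F"
    using r(1) cgenideal_ideal cgenideal_self by (simp add: F_def)
  then have "F \<noteq> {}" by blast
  then have "\<exists>K\<in>F. \<forall>I\<in>F. K \<subseteq> I \<longrightarrow> I = K"
    by (rule noetherian_maximal_ideal_exists[OF noeth]) (simp add: F_def)
  then obtain K where K: "K \<in> F" "\<And>I. I \<in> F \<Longrightarrow> K \<subseteq> I \<Longrightarrow> I = K"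
    by blast
  have "maximalideal K R"
  proof (rule maximalidealI)
    show "ideal K R" "carrier R \<noteq> K" using K(1) by (auto simp: F_def)
    show "J = K \<or> J = carrier R" if J: "ideal J R" "K \<subseteq> J" "J \<subseteq> carrier R" for J
      using K(2)[of J] K(1) J ideal.one_imp_carrier[OF J(1)] by (auto simp: F_def)
  qed
  then show False using loc K(1) r(2) by (auto simp: local_ring_def F_def)
qed

lemma ideal_adjoin:
  assumes K: "ideal K R" and p: "p \<in> carrier R"
  shows "ideal {c \<oplus> r \<otimes> p | c r. c \<in> K \<and> r \<in> carrier R} R" (is "ideal ?L R")
    and "K \<subseteq> {c \<oplus> r \<otimes> p | c r. c \<in> K \<and> r \<in> carrier R}"
    and "p \<in> {c \<oplus> r \<otimes> p | c r. c \<in> K \<and> r \<in> carrier R}"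
proof -
  note Kc = ideal.Icarr[OF K]
  have "c = c \<oplus> \<zero> \<otimes> p" if "c \<in> K" for c using Kc[OF that] p by simp
  then show KL: "K \<subseteq> ?L" using zero_closed by blast
  have "p = \<zero> \<oplus> \<one> \<otimes> p" using p by simp
  then show "p \<in> ?L" using ideal_zero_mem[OF K] one_closed by blast
  show "ideal ?L R"
  proof (rule idealI_combination)
    show "?L \<subseteq> carrier R" using p Kc by auto
    show "\<zero> \<in> ?L" using KL ideal_zero_mem[OF K] by blast
    fix s a b assume s: "s \<in> carrier R" and ab: "a \<in> ?L" "b \<in> ?L"
    obtain c r where a: "c \<in> K" "r \<in> carrier R" "a = c \<oplus> r \<otimes> p" using ab(1) by blast
    obtain d t where b: "d \<in> K" "t \<in> carrier R" "b = d \<oplus> t \<otimes> p" using ab(2) by blast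
    have "s \<otimes> a \<oplus> b = (s \<otimes> c \<oplus> d) \<oplus> (s \<otimes> r \<oplus> t) \<otimes> p"
      unfolding a(3) b(3) using s a(2) b(2) Kc[OF a(1)] Kc[OF b(1)] p by algebra
    moreover have "s \<otimes> c \<oplus> d \<in> K"
      using a b s by (intro ideal_add_mem[OF K] ideal.I_l_closed[OF K])
    moreover have "s \<otimes> r \<oplus> t \<in> carrier R" using s a b by simp
    ultimately show "s \<otimes> a \<oplus> b \<in> ?L" by blast
  qed
qed

text \<open>No bases over the residue field are chosen: the complement \<open>K\<close> is an ideal
  between two consecutive powers that is maximal subject to injectivity of \<open>x\<close> modulo
  \<open>K\<close>. If an element \<open>p\<close> were missing from \<open>x\<close> times the
  power of exponent \<open>j\<close> plus \<open>K\<close>, then \<open>p\<close> could be adjoined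
  to \<open>K\<close> without losing injectivity; \<open>units\<close> provides the division by
  scalars outside \<open>I\<close>.\<close>

lemma built_from_pred_power:
  assumes noeth: "noetherian_ring R" and I: "ideal I R"
    and units: "\<And>r. r \<in> carrier R \<Longrightarrow> r \<notin> I \<Longrightarrow> r \<in> Units R"
    and x: "x \<in> I"
    and sup: "\<And>w. w \<in> ideal_power R I j \<Longrightarrow> x \<otimes> w \<in> ideal_power R I (Suc (Suc j)) \<Longrightarrow>
      w \<in> ideal_power R I (Suc j)"
    and built: "built_from R M (quotient_module R (ideal_power R I (Suc j)))"
  shows "built_from R M (quotient_module R (ideal_power R I j))"
proof -
  note pI = ideal_power_ideal[OF I]
  have xc: "x \<in> carrier R" using ideal.Icarr[OF I x] .
  define F where "F = {K. ideal K R \<and> ideal_power R I (Suc (Suc j)) \<subseteq> K \<and> K \<subseteq> ideal_power R I (Suc j) \<and>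
    (\<forall>w\<in>ideal_power R I j. x \<otimes> w \<in> K \<longrightarrow> w \<in> ideal_power R I (Suc j))}"
  have "ideal_power R I (Suc (Suc j)) \<subseteq> ideal_power R I (Suc j)"
    by (rule ideal_power_antimono[OF I]) simp
  \<comment> \<open>The family is nonempty: for the smallest candidate, the injectivity condition is
    exactly \<open>sup\<close>.\<close>
  then have "ideal_power R I (Suc (Suc j)) \<in> F"
    unfolding F_def mem_Collect_eq by (intro conjI ballI impI pI order_refl) (assumption, erule (1) sup)
  then have "F \<noteq> {}" by blast
  then have "\<exists>K\<in>F. \<forall>L\<in>F. K \<subseteq> L \<longrightarrow> L = K"
    by (rule noetherian_maximal_ideal_exists[OF noeth]) (simp add: F_def)
  then obtain K where KF: "K \<in> F" and max: "\<And>L. L \<in> F \<Longrightarrow> K \<subseteq> L \<Longrightarrow> L = K"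
    by blast
  have K: "ideal K R" and lower: "ideal_power R I (Suc (Suc j)) \<subseteq> K" and upper: "K \<subseteq> ideal_power R I (Suc j)"
    and Kinj: "\<And>w. w \<in> ideal_power R I j \<Longrightarrow> x \<otimes> w \<in> K \<Longrightarrow> w \<in> ideal_power R I (Suc j)"
    using KF by (auto simp: F_def)
  have span: "\<exists>u\<in>ideal_power R I j. \<exists>c\<in>K. p = x \<otimes> u \<oplus> c" if p: "p \<in> ideal_power R I (Suc j)" for p
  proof (rule ccontr)
    assume no: "\<not> ?thesis"
    have pc: "p \<in> carrier R" using ideal_power_carrier[OF I p] .
    define L where "L = {c \<oplus> r \<otimes> p | c r. c \<in> K \<and> r \<in> carrier R}"
    have L: "ideal L R" and KL: "K \<subseteq> L" and pL: "p \<in> L"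
      unfolding L_def using ideal_adjoin[OF K pc] by auto
    have "ideal_power R I (Suc (Suc j)) \<subseteq> L" using lower KL by simp
    moreover have "L \<subseteq> ideal_power R I (Suc j)"
      using upper by (auto simp: L_def intro!: ideal_add_mem[OF pI] ideal.I_l_closed[OF pI p])
    moreover have "w \<in> ideal_power R I (Suc j)" if w: "w \<in> ideal_power R I j" and xw: "x \<otimes> w \<in> L" for w
    proof -
      obtain c r where c: "c \<in> K" and r: "r \<in> carrier R" and eq: "x \<otimes> w = c \<oplus> r \<otimes> p"
        using xw by (auto simp: L_def)
      have cw: "c \<in> carrier R" "w \<in> carrier R"
        using ideal.Icarr[OF K c] ideal_power_carrier[OF I w] by auto
      \<comment> \<open>Otherwise \<open>r\<close> is invertible, and solving the equation for
        \<open>p\<close> writes it in the form excluded by \<open>no\<close>.\<close>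
      have "r \<in> I"
      proof (rule ccontr)
        assume "r \<notin> I"
        then have ru: "r \<in> Units R" using units r by simp
        then have ri: "inv r \<in> carrier R" by simp
        have "inv r \<otimes> (x \<otimes> w) = inv r \<otimes> c \<oplus> (inv r \<otimes> r) \<otimes> p"
          unfolding eq using ri r cw pc by (simp add: r_distr m_assoc)
        then have "inv r \<otimes> (x \<otimes> w) = inv r \<otimes> c \<oplus> p"
          using Units_l_inv[OF ru] pc by simp
        moreover have "x \<otimes> (inv r \<otimes> w) \<oplus> \<ominus> (inv r \<otimes> c) = inv r \<otimes> (x \<otimes> w) \<ominus> inv r \<otimes> c"
          using ri cw xc by algebra
        moreover have "(inv r \<otimes> c \<oplus> p) \<ominus> inv r \<otimes> c = p"
          using ri cw pc by algebra
        ultimately have "p = x \<otimes> (inv r \<otimes> w) \<oplus> \<ominus> (inv r \<otimes> c)" by simp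
        moreover have "inv r \<otimes> w \<in> ideal_power R I j"
          using ideal.I_l_closed[OF pI w ri] .
        moreover have "\<ominus> (inv r \<otimes> c) \<in> K"
          using ideal_neg_mem[OF K ideal.I_l_closed[OF K c ri]] .
        ultimately show False using no by blast
      qed
      \<comment> \<open>With \<open>r\<close> in \<open>I\<close>, the product moves up one degree
        and lands in the lower bound of \<open>K\<close>, so adjoining \<open>p\<close> adds nothing
        to this equation.\<close>
      then have "r \<otimes> p \<in> K" using lower ideal_power_mult1[OF I _ p] by auto
      then have "x \<otimes> w \<in> K" unfolding eq using ideal_add_mem[OF K c] by simp
      then show ?thesis using Kinj w by simp
    qed
    ultimately have "L \<in> F" unfolding F_def using L by blast
    then have "L = K" using max KL by simp
    then have "p = x \<otimes> \<zero> \<oplus> p" "p \<in> K" using xc pc pL by auto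
    then show False using no ideal_zero_mem[OF pI] by blast
  qed
  let ?Y = "quotient_module R (ideal_power R I j)" and ?Z = "quotient_module R K"
  have "\<exists>f g. short_exact R (quotient_module R (ideal_power R I (Suc j))) (direct_sum ?Y ?Z)
      (quotient_module R (ideal_power R I (Suc j))) f g"
  proof (rule quotient_sum_short_exact[OF pI pI K xc upper])
    show "ideal_power R I (Suc j) \<subseteq> ideal_power R I j" by (rule ideal_power_antimono[OF I]) simp
    show "x \<otimes> a \<in> K" if "a \<in> ideal_power R I (Suc j)" for a
      using lower ideal_power_mult1[OF I x that] by auto
    show "x \<otimes> a \<in> ideal_power R I (Suc j)" if "a \<in> ideal_power R I j" for a
      by (rule ideal_power_mult1[OF I x that])
  qed (fact Kinj, fact span)
  then obtain f g where ex: "short_exact R (quotient_module R (ideal_power R I (Suc j))) (direct_sum ?Y ?Z)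
      (quotient_module R (ideal_power R I (Suc j))) f g" by blast
  have "\<exists>X\<in>mod_cat R. module_iso R X (direct_sum ?Y ?Z)"
  proof (rule mod_cat_representative[OF fin_gen_direct_sum])
    \<comment> \<open>A pair of cosets is parametrised by the first two entries of a
      sequence.\<close>
    show "carrier (direct_sum ?Y ?Z) \<subseteq> range (\<lambda>v. (ideal_power R I j +> v 0, K +> v (Suc 0)))"
    proof
      fix y assume "y \<in> carrier (direct_sum ?Y ?Z)"
      then obtain a b where "y = (ideal_power R I j +> a, K +> b)"
        by (auto simp: direct_sum_def quotient_module_carrier)
      then show "y \<in> range (\<lambda>v. (ideal_power R I j +> v 0, K +> v (Suc 0)))"
        by (intro image_eqI[of _ _ "\<lambda>i. if i = 0 then a else b"]) auto
    qed
  qed (intro fin_gen_quotient_module pI K)+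
  then obtain X where X: "X \<in> mod_cat R" "module_iso R X (direct_sum ?Y ?Z)" by blast
  have "built_from R M (direct_sum ?Y ?Z)"
    by (rule built_from_extension[OF built built ex X quotient_module_module[OF pI]])
  moreover obtain Y' Z' where "Y' \<in> mod_cat R" "module_iso R Y' ?Y" "Z' \<in> mod_cat R" "module_iso R Z' ?Z"
    using quotient_module_representative[OF pI] quotient_module_representative[OF K] by metis
  ultimately show ?thesis by (rule built_from_summand)
qed

end

subsection \<open>Modules of finite length\<close>

context module
begin

text \<open>The coefficients range over an ideal because \<open>H + Ry\<close> will be compared with
  \<open>H + Iy\<close>.\<close>

lemma submodule_adjoin:
  assumes H: "submodule H R M" and y: "y \<in> carrier M" and I: "ideal I R"
  shows "submodule {h \<oplus>\<^bsub>M\<^esub> a \<odot>\<^bsub>M\<^esub> y | h a. h \<in> H \<and> a \<in> I} R M" (is "submodule ?K R M")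
    and "H \<subseteq> {h \<oplus>\<^bsub>M\<^esub> a \<odot>\<^bsub>M\<^esub> y | h a. h \<in> H \<and> a \<in> I}"
proof -
  note HE = submoduleE[OF H]
  note Ic = ideal.Icarr[OF I]
  have H0: "\<zero>\<^bsub>M\<^esub> \<in> H" using HE(2) HE(4)[of "\<zero>"] HE(1) by fastforce
  have "h = h \<oplus>\<^bsub>M\<^esub> \<zero> \<odot>\<^bsub>M\<^esub> y" if "h \<in> H" for h using that y HE(1) by auto
  then show HK: "H \<subseteq> ?K" using R.ideal_zero_mem[OF I] by blast
  have smult: "r \<odot>\<^bsub>M\<^esub> x \<in> ?K" if r: "r \<in> carrier R" and x: "x \<in> ?K" for r x
  proof -
    obtain h a where *: "h \<in> H" "a \<in> I" "x = h \<oplus>\<^bsub>M\<^esub> a \<odot>\<^bsub>M\<^esub> y" using x by blast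
    have "h \<in> carrier M" "a \<in> carrier R" using * HE(1) Ic by auto
    then have "r \<odot>\<^bsub>M\<^esub> x = r \<odot>\<^bsub>M\<^esub> h \<oplus>\<^bsub>M\<^esub> (r \<otimes> a) \<odot>\<^bsub>M\<^esub> y"
      using * r y by (simp add: smult_r_distr smult_assoc1)
    moreover have "r \<odot>\<^bsub>M\<^esub> h \<in> H" "r \<otimes> a \<in> I"
      using * r HE(4) ideal.I_l_closed[OF I] by auto
    ultimately show ?thesis by blast
  qed
  have sub: "?K \<subseteq> carrier M" using HE(1) Ic y by auto
  show "submodule ?K R M"
  proof (rule submoduleI[OF sub])
    show "\<zero>\<^bsub>M\<^esub> \<in> ?K" using HK H0 by blast
    show "\<ominus>\<^bsub>M\<^esub> x \<in> ?K" if "x \<in> ?K" for x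
    proof -
      have "\<ominus> \<one> \<odot>\<^bsub>M\<^esub> x \<in> ?K" by (rule smult[OF _ that]) simp
      moreover have "x \<in> carrier M" using that sub by blast
      ultimately show ?thesis by (simp add: smult_l_minus)
    qed
    show "x \<oplus>\<^bsub>M\<^esub> z \<in> ?K" if xz: "x \<in> ?K" "z \<in> ?K" for x z
    proof -
      obtain h a where x: "h \<in> H" "a \<in> I" "x = h \<oplus>\<^bsub>M\<^esub> a \<odot>\<^bsub>M\<^esub> y" using xz(1) by blast
      obtain g b where z: "g \<in> H" "b \<in> I" "z = g \<oplus>\<^bsub>M\<^esub> b \<odot>\<^bsub>M\<^esub> y" using xz(2) by blast
      have c: "h \<in> carrier M" "g \<in> carrier M" "a \<in> carrier R" "b \<in> carrier R"
        using x z HE(1) Ic by auto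
      have "x \<oplus>\<^bsub>M\<^esub> z = (h \<oplus>\<^bsub>M\<^esub> g) \<oplus>\<^bsub>M\<^esub> (a \<oplus> b) \<odot>\<^bsub>M\<^esub> y"
        using x(3) z(3) c y by (simp add: smult_l_distr M.a_ac)
      moreover have "h \<oplus>\<^bsub>M\<^esub> g \<in> H" "a \<oplus> b \<in> I"
        using x z HE(5) R.ideal_add_mem[OF I] by auto
      ultimately show ?thesis by blast
    qed
  qed (rule smult)
qed

lemma submodule_restrict:
  assumes "submodule H R M" "submodule K R (M\<lparr>carrier := H\<rparr>)"
  shows "submodule K R M"
proof -
  have "subgroup K (add_monoid M)"
  proof (rule group.incl_subgroup)
    show "subgroup H (add_monoid M)" using submodule.axioms(1)[OF assms(1)] .
    show "subgroup K (add_monoid M\<lparr>carrier := H\<rparr>)" using submodule.axioms(1)[OF assms(2)] by simp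
  qed (rule M.a_group)
  then show ?thesis
    using submodule.smult_closed[OF assms(2)] by (simp add: submodule_def submodule_axioms_def)
qed

text \<open>This identifies a simple module over a local ring with the residue field. Any
  \<open>y\<close> in \<open>H'\<close> outside \<open>H\<close> generates modulo \<open>H\<close>.
  By simplicity \<open>H + Iy\<close> is \<open>H\<close> or \<open>H'\<close>, and Nakayama's
  argument excludes \<open>H'\<close>, so \<open>I\<close> annihilates \<open>y\<close> modulo
  \<open>H\<close>; units do not.\<close>

lemma simple_quotient_generator:
  assumes I: "ideal I R" "I \<noteq> carrier R"
    and units: "\<And>r. r \<in> carrier R \<Longrightarrow> r \<notin> I \<Longrightarrow> r \<in> Units R"
    and H: "submodule H R M" and H': "submodule H' R M" and less: "H \<subset> H'"
    and simple: "\<And>K. submodule K R M \<Longrightarrow> H \<subseteq> K \<Longrightarrow> K \<subseteq> H' \<Longrightarrow> K = H \<or> K = H'"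
  shows "\<exists>y\<in>H'. H' = {h \<oplus>\<^bsub>M\<^esub> a \<odot>\<^bsub>M\<^esub> y | h a. h \<in> H \<and> a \<in> carrier R} \<and>
    (\<forall>a\<in>carrier R. a \<odot>\<^bsub>M\<^esub> y \<in> H \<longleftrightarrow> a \<in> I)"
proof -
  note HE = submoduleE[OF H] and HE' = submoduleE[OF H']
  note Ic = ideal.Icarr[OF I(1)]
  obtain y where y: "y \<in> H'" "y \<notin> H" using less by blast
  then have yc: "y \<in> carrier M" using HE'(1) by auto
  have H0: "\<zero>\<^bsub>M\<^esub> \<in> H" using HE(2) HE(4)[of "\<zero>"] HE(1) by fastforce
  have unit: "y \<in> H" if "u \<in> Units R" "u \<odot>\<^bsub>M\<^esub> y \<in> H" for u
  proof -
    have "inv u \<odot>\<^bsub>M\<^esub> (u \<odot>\<^bsub>M\<^esub> y) \<in> H" using that(1) by (intro HE(4)[OF _ that(2)]) simp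
    moreover have "inv u \<odot>\<^bsub>M\<^esub> (u \<odot>\<^bsub>M\<^esub> y) = y"
      using that(1) yc smult_assoc1[of "inv u" u y] R.Units_closed by simp
    ultimately show ?thesis by simp
  qed
  let ?K = "\<lambda>J. {h \<oplus>\<^bsub>M\<^esub> a \<odot>\<^bsub>M\<^esub> y | h a. h \<in> H \<and> a \<in> J}"
  have mem: "a \<odot>\<^bsub>M\<^esub> y \<in> ?K J" if "a \<in> J" "a \<in> carrier R" for a J
  proof -
    have "a \<odot>\<^bsub>M\<^esub> y = \<zero>\<^bsub>M\<^esub> \<oplus>\<^bsub>M\<^esub> a \<odot>\<^bsub>M\<^esub> y" using that yc by simp
    then show ?thesis using H0 that by blast
  qed
  have cases: "?K J = H \<or> ?K J = H'" if J: "ideal J R" for J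
  proof (rule simple[OF submodule_adjoin[OF H yc J]])
    show "?K J \<subseteq> H'"
      using less HE'(4,5) y(1) ideal.Icarr[OF J] by auto
  qed
  have "y \<in> ?K (carrier R)" using mem[of \<one> "carrier R"] yc by simp
  then have "?K (carrier R) \<noteq> H" using y(2) by blast
  then have gen: "H' = ?K (carrier R)" using cases[OF R.oneideal] by blast
  \<comment> \<open>Nakayama: \<open>y = h + a y\<close> with \<open>a\<close> in \<open>I\<close>
    gives \<open>(1 - a) y\<close> in \<open>H\<close>, and \<open>1 - a\<close> is a unit.\<close>
  have "?K I \<noteq> H'"
  proof
    assume "?K I = H'"
    then have "y \<in> ?K I" using y(1) by simp
    then obtain h a where *: "h \<in> H" "a \<in> I" "y = h \<oplus>\<^bsub>M\<^esub> a \<odot>\<^bsub>M\<^esub> y" by blast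
    have c: "h \<in> carrier M" "a \<in> carrier R" using * HE(1) Ic by auto
    have "(\<one> \<ominus> a) \<odot>\<^bsub>M\<^esub> y = y \<ominus>\<^bsub>M\<^esub> a \<odot>\<^bsub>M\<^esub> y"
      using c yc by (simp add: a_minus_def smult_l_distr smult_l_minus)
    also have "\<dots> = (h \<oplus>\<^bsub>M\<^esub> a \<odot>\<^bsub>M\<^esub> y) \<ominus>\<^bsub>M\<^esub> a \<odot>\<^bsub>M\<^esub> y" using *(3) by simp
    also have "\<dots> = h" using c yc by (simp add: a_minus_def M.a_assoc M.r_neg)
    finally have eq: "(\<one> \<ominus> a) \<odot>\<^bsub>M\<^esub> y \<in> H" using *(1) by simp
    have "\<one> \<ominus> a \<notin> I"
    proof
      assume "\<one> \<ominus> a \<in> I"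
      then have "(\<one> \<ominus> a) \<oplus> a \<in> I" using *(2) R.ideal_add_mem[OF I(1)] by simp
      moreover have "(\<one> \<ominus> a) \<oplus> a = \<one>" using c by (simp add: a_minus_def R.a_assoc R.l_neg)
      ultimately show False using ideal.one_imp_carrier[OF I(1)] I(2) by simp
    qed
    then have "\<one> \<ominus> a \<in> Units R" using units c by simp
    then show False using unit eq y(2) by blast
  qed
  then have "?K I = H" using cases[OF I(1)] by blast
  then have "a \<odot>\<^bsub>M\<^esub> y \<in> H \<longleftrightarrow> a \<in> I" if "a \<in> carrier R" for a
    using mem[of a I] that unit[of a] units[of a] y(2) by blast
  then show ?thesis using y(1) gen by (intro bexI[of _ y] conjI ballI)
qed

text \<open>The surjection reads off the coefficient of \<open>y\<close> modulo \<open>I\<close>. If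
  an element has two such expressions, the difference of their coefficients moves \<open>y\<close>
  into \<open>H\<close>, so \<open>ann\<close> makes the map well defined; the same equivalence
  identifies its kernel.\<close>

lemma simple_quotient_short_exact:
  assumes I: "ideal I R" and H: "submodule H R M" and y: "y \<in> carrier M"
    and ann: "\<And>a. a \<in> carrier R \<Longrightarrow> a \<odot>\<^bsub>M\<^esub> y \<in> H \<longleftrightarrow> a \<in> I"
    and H': "H' = {h \<oplus>\<^bsub>M\<^esub> a \<odot>\<^bsub>M\<^esub> y | h a. h \<in> H \<and> a \<in> carrier R}"
  shows "\<exists>f g. short_exact R (M\<lparr>carrier := H\<rparr>) (M\<lparr>carrier := H'\<rparr>) (quotient_module R I) f g"
proof -
  note HE = submoduleE[OF H]
  have H0: "\<zero>\<^bsub>M\<^esub> \<in> H" using HE(2) HE(4)[of "\<zero>"] HE(1) by fastforce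
  have HH': "H \<subseteq> H'" using submodule_adjoin(2)[OF H y R.oneideal] H' by simp
  define g where "g z = (THE Y. \<exists>h\<in>H. \<exists>a\<in>carrier R. z = h \<oplus>\<^bsub>M\<^esub> a \<odot>\<^bsub>M\<^esub> y \<and> Y = I +> a)" for z
  have g: "g (h \<oplus>\<^bsub>M\<^esub> a \<odot>\<^bsub>M\<^esub> y) = I +> a" if h: "h \<in> H" and a: "a \<in> carrier R" for h a
    unfolding g_def
  proof (rule the_equality)
    show "\<exists>h'\<in>H. \<exists>b\<in>carrier R. h \<oplus>\<^bsub>M\<^esub> a \<odot>\<^bsub>M\<^esub> y = h' \<oplus>\<^bsub>M\<^esub> b \<odot>\<^bsub>M\<^esub> y \<and> I +> a = I +> b"
      using h a by blast
    fix Y assume "\<exists>h'\<in>H. \<exists>b\<in>carrier R. h \<oplus>\<^bsub>M\<^esub> a \<odot>\<^bsub>M\<^esub> y = h' \<oplus>\<^bsub>M\<^esub> b \<odot>\<^bsub>M\<^esub> y \<and> Y = I +> b"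
    then obtain k b where k: "k \<in> H" and b: "b \<in> carrier R" and Y: "Y = I +> b"
      and eq: "h \<oplus>\<^bsub>M\<^esub> a \<odot>\<^bsub>M\<^esub> y = k \<oplus>\<^bsub>M\<^esub> b \<odot>\<^bsub>M\<^esub> y" by blast
    have c: "h \<in> carrier M" "k \<in> carrier M" "a \<odot>\<^bsub>M\<^esub> y \<in> carrier M" "b \<odot>\<^bsub>M\<^esub> y \<in> carrier M"
      using h k a b y HE(1) by auto
    have "(b \<ominus> a) \<odot>\<^bsub>M\<^esub> y = b \<odot>\<^bsub>M\<^esub> y \<ominus>\<^bsub>M\<^esub> a \<odot>\<^bsub>M\<^esub> y"
      using a b y by (simp add: a_minus_def smult_l_distr smult_l_minus)
    also have "\<dots> = (\<ominus>\<^bsub>M\<^esub> k \<oplus>\<^bsub>M\<^esub> (k \<oplus>\<^bsub>M\<^esub> b \<odot>\<^bsub>M\<^esub> y)) \<ominus>\<^bsub>M\<^esub> a \<odot>\<^bsub>M\<^esub> y"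
      using c by (simp add: M.r_neg1)
    also have "\<dots> = (\<ominus>\<^bsub>M\<^esub> k \<oplus>\<^bsub>M\<^esub> (h \<oplus>\<^bsub>M\<^esub> a \<odot>\<^bsub>M\<^esub> y)) \<ominus>\<^bsub>M\<^esub> a \<odot>\<^bsub>M\<^esub> y" by (simp only: eq)
    also have "\<dots> = \<ominus>\<^bsub>M\<^esub> k \<oplus>\<^bsub>M\<^esub> h" using c by (simp add: a_minus_def M.a_assoc M.r_neg)
    finally have "(b \<ominus> a) \<odot>\<^bsub>M\<^esub> y \<in> H" using HE(3,5) h k by simp
    then have "b \<ominus> a \<in> I" using ann a b by simp
    then show "Y = I +> a" unfolding Y using R.rcos_eq_iff[OF I b a] by simp
  qed
  interpret Q: module R "quotient_module R I" by (rule R.quotient_module_module[OF I])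
  have "short_exact R (M\<lparr>carrier := H\<rparr>) (M\<lparr>carrier := H'\<rparr>) (quotient_module R I) (\<lambda>x. x) g"
    unfolding short_exact_def
  proof (intro conjI)
    show "(\<lambda>x. x) \<in> module_hom R (M\<lparr>carrier := H\<rparr>) (M\<lparr>carrier := H'\<rparr>)"
      by (rule module_homI) (use HH' in auto)
    show "g \<in> module_hom R (M\<lparr>carrier := H'\<rparr>) (quotient_module R I)"
    proof (rule module_homI; simp)
      fix x assume "x \<in> H'"
      then show "g x \<in> carrier (quotient_module R I)"
        unfolding H' using g by (auto simp: R.quotient_module_carrier)
    next
      fix x z assume "x \<in> H'" "z \<in> H'"
      then obtain h a k b where x: "x = h \<oplus>\<^bsub>M\<^esub> a \<odot>\<^bsub>M\<^esub> y" "h \<in> H" "a \<in> carrier R"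
        and z: "z = k \<oplus>\<^bsub>M\<^esub> b \<odot>\<^bsub>M\<^esub> y" "k \<in> H" "b \<in> carrier R"
        unfolding H' by blast
      have c: "h \<in> carrier M" "k \<in> carrier M" using x z HE(1) by auto
      have "x \<oplus>\<^bsub>M\<^esub> z = (h \<oplus>\<^bsub>M\<^esub> k) \<oplus>\<^bsub>M\<^esub> (a \<oplus> b) \<odot>\<^bsub>M\<^esub> y"
        using x(1,3) z(1,3) c y by (simp add: smult_l_distr M.a_ac)
      then show "g (x \<oplus>\<^bsub>M\<^esub> z) = g x \<oplus>\<^bsub>quotient_module R I\<^esub> g z"
        using g[of "h \<oplus>\<^bsub>M\<^esub> k" "a \<oplus> b"] g[of h a] g[of k b] x z HE(5)
        by (simp add: R.quotient_module_add[OF I])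
    next
      fix r x assume r: "r \<in> carrier R" and "x \<in> H'"
      then obtain h a where x: "x = h \<oplus>\<^bsub>M\<^esub> a \<odot>\<^bsub>M\<^esub> y" "h \<in> H" "a \<in> carrier R"
        unfolding H' by blast
      have "h \<in> carrier M" using x HE(1) by auto
      then have "r \<odot>\<^bsub>M\<^esub> x = r \<odot>\<^bsub>M\<^esub> h \<oplus>\<^bsub>M\<^esub> (r \<otimes> a) \<odot>\<^bsub>M\<^esub> y"
        using x(1,3) r y by (simp add: smult_r_distr smult_assoc1)
      then show "g (r \<odot>\<^bsub>M\<^esub> x) = r \<odot>\<^bsub>quotient_module R I\<^esub> g x"
        using g[of "r \<odot>\<^bsub>M\<^esub> h" "r \<otimes> a"] g[of h a] x r HE(4)
        by (simp add: R.quotient_module_smult[OF I])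
    qed
    show "inj_on (\<lambda>x. x) (carrier (M\<lparr>carrier := H\<rparr>))" by simp
    show "g ` carrier (M\<lparr>carrier := H'\<rparr>) = carrier (quotient_module R I)"
    proof
      show "g ` carrier (M\<lparr>carrier := H'\<rparr>) \<subseteq> carrier (quotient_module R I)"
        using g by (auto simp: H' R.quotient_module_carrier)
      show "carrier (quotient_module R I) \<subseteq> g ` carrier (M\<lparr>carrier := H'\<rparr>)"
      proof
        fix Y assume "Y \<in> carrier (quotient_module R I)"
        then obtain a where a: "a \<in> carrier R" "Y = I +> a" by (auto simp: R.quotient_module_carrier)
        then have "Y = g (\<zero>\<^bsub>M\<^esub> \<oplus>\<^bsub>M\<^esub> a \<odot>\<^bsub>M\<^esub> y)" using g[OF H0] by simp
        moreover have "\<zero>\<^bsub>M\<^esub> \<oplus>\<^bsub>M\<^esub> a \<odot>\<^bsub>M\<^esub> y \<in> H'" unfolding H' using H0 a by blast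
        ultimately show "Y \<in> g ` carrier (M\<lparr>carrier := H'\<rparr>)" by simp
      qed
    qed
    have "h \<oplus>\<^bsub>M\<^esub> a \<odot>\<^bsub>M\<^esub> y \<in> H \<longleftrightarrow> a \<odot>\<^bsub>M\<^esub> y \<in> H" if "h \<in> H" "a \<in> carrier R" for h a
    proof
      assume "h \<oplus>\<^bsub>M\<^esub> a \<odot>\<^bsub>M\<^esub> y \<in> H"
      then have "\<ominus>\<^bsub>M\<^esub> h \<oplus>\<^bsub>M\<^esub> (h \<oplus>\<^bsub>M\<^esub> a \<odot>\<^bsub>M\<^esub> y) \<in> H" using HE(3,5) that by simp
      moreover have "h \<in> carrier M" using that HE(1) by auto
      ultimately show "a \<odot>\<^bsub>M\<^esub> y \<in> H" using that y by (simp add: M.r_neg1)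
    qed (use HE(5) that in simp)
    then have ker: "g (h \<oplus>\<^bsub>M\<^esub> a \<odot>\<^bsub>M\<^esub> y) = I \<longleftrightarrow> h \<oplus>\<^bsub>M\<^esub> a \<odot>\<^bsub>M\<^esub> y \<in> H"
      if "h \<in> H" "a \<in> carrier R" for h a
      using that g R.rcos_eq_self_iff[OF I] ann by simp
    have "x \<in> H \<longleftrightarrow> g x = I" if "x \<in> H'" for x
      using that ker unfolding H' by blast
    then show "(\<lambda>x. x) ` carrier (M\<lparr>carrier := H\<rparr>) =
        {x \<in> carrier (M\<lparr>carrier := H'\<rparr>). g x = \<zero>\<^bsub>quotient_module R I\<^esub>}"
      using HH' by (auto simp: R.quotient_module_zero)
  qed
  then show ?thesis by blast
qed

lemma built_from_composition_series:
  assumes I: "ideal I R" "I \<noteq> carrier R"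
    and units: "\<And>r. r \<in> carrier R \<Longrightarrow> r \<notin> I \<Longrightarrow> r \<in> Units R"
    and built: "built_from R L (quotient_module R I)"
    and H0: "H 0 = {\<zero>\<^bsub>M\<^esub>}" and H: "\<And>i. i \<le> l \<Longrightarrow> submodule (H i) R M"
    and less: "\<And>i. i < l \<Longrightarrow> H i \<subset> H (Suc i)"
    and simple: "\<And>i K. i < l \<Longrightarrow> submodule K R M \<Longrightarrow> H i \<subseteq> K \<Longrightarrow> K \<subseteq> H (Suc i) \<Longrightarrow>
      K = H i \<or> K = H (Suc i)"
  shows "built_from R L (M\<lparr>carrier := H l\<rparr>)"
proof -
  have mod: "module R (M\<lparr>carrier := H i\<rparr>)" if "i \<le> l" for i
    using submodule.submodule_is_module[OF H[OF that] module_axioms] .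
  \<comment> \<open>Closure under extensions needs a copy of each \<open>H i\<close> in
    \<open>mod_cat\<close>, so the induction also carries a finite generating set \<open>S\<close>
    and a parametrisation \<open>p\<close> by sequences. Generation is expressed with submodules of
    \<open>M\<close>, which makes the sets for different \<open>i\<close> comparable.\<close>
  have "\<exists>S p. finite S \<and> S \<subseteq> H i \<and> (\<forall>K. submodule K R M \<and> S \<subseteq> K \<longrightarrow> H i \<subseteq> K) \<and>
      H i \<subseteq> range (p :: (nat \<Rightarrow> 'a) \<Rightarrow> 'c) \<and> built_from R L (M\<lparr>carrier := H i\<rparr>)"
    if "i \<le> l" for i
    using that
  proof (induction i)
    case 0
    have "built_from R L (M\<lparr>carrier := H 0\<rparr>)"
      by (rule built_from_zero[OF built mod]) (simp_all add: H0)
    then show ?case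
      using H0 by (intro exI[of _ "H 0"] exI[of _ "\<lambda>_. \<zero>\<^bsub>M\<^esub>"]) auto
  next
    case (Suc i)
    then have i: "i < l" "i \<le> l" by auto
    obtain S and p :: "(nat \<Rightarrow> 'a) \<Rightarrow> 'c" where Sp: "finite S \<and> S \<subseteq> H i \<and>
        (\<forall>K. submodule K R M \<and> S \<subseteq> K \<longrightarrow> H i \<subseteq> K) \<and> H i \<subseteq> range p \<and> built_from R L (M\<lparr>carrier := H i\<rparr>)"
      using Suc.IH[OF i(2)] by (elim exE)
    then have S: "finite S" "S \<subseteq> H i" "\<And>K. submodule K R M \<Longrightarrow> S \<subseteq> K \<Longrightarrow> H i \<subseteq> K"
      and p: "H i \<subseteq> range p" and bi: "built_from R L (M\<lparr>carrier := H i\<rparr>)"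
      by blast+
    have "\<exists>y\<in>H (Suc i). H (Suc i) = {h \<oplus>\<^bsub>M\<^esub> a \<odot>\<^bsub>M\<^esub> y | h a. h \<in> H i \<and> a \<in> carrier R} \<and>
        (\<forall>a\<in>carrier R. a \<odot>\<^bsub>M\<^esub> y \<in> H i \<longleftrightarrow> a \<in> I)"
      by (rule simple_quotient_generator[OF I units H[OF i(2)] H[OF Suc.prems] less[OF i(1)] simple[OF i(1)]])
    then obtain y where y: "y \<in> H (Suc i)"
      and gen: "H (Suc i) = {h \<oplus>\<^bsub>M\<^esub> a \<odot>\<^bsub>M\<^esub> y | h a. h \<in> H i \<and> a \<in> carrier R}"
      and "\<forall>a\<in>carrier R. a \<odot>\<^bsub>M\<^esub> y \<in> H i \<longleftrightarrow> a \<in> I"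
      by (elim bexE conjE)
    then have ann: "\<And>a. a \<in> carrier R \<Longrightarrow> a \<odot>\<^bsub>M\<^esub> y \<in> H i \<longleftrightarrow> a \<in> I" by blast
    have yc: "y \<in> carrier M" using submoduleE(1)[OF H[OF Suc.prems]] y by auto
    obtain f g where ex: "short_exact R (M\<lparr>carrier := H i\<rparr>) (M\<lparr>carrier := H (Suc i)\<rparr>) (quotient_module R I) f g"
      using simple_quotient_short_exact[OF I(1) H[OF i(2)] yc ann gen] by blast
    have S': "H (Suc i) \<subseteq> K" if K: "submodule K R M" "insert y S \<subseteq> K" for K
    proof -
      have "H i \<subseteq> K" using S(3) K by simp
      then show ?thesis using submoduleE(4,5)[OF K(1)] K(2) by (auto simp: gen)
    qed
    \<comment> \<open>Entry 0 of the sequence is the coefficient of the new generator, and the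
      remaining entries feed the previous parametrisation.\<close>
    define q where "q v = p (\<lambda>j. v (Suc j)) \<oplus>\<^bsub>M\<^esub> v 0 \<odot>\<^bsub>M\<^esub> y" for v
    have q: "H (Suc i) \<subseteq> range q"
    proof
      fix z assume "z \<in> H (Suc i)"
      then obtain h a where "z = h \<oplus>\<^bsub>M\<^esub> a \<odot>\<^bsub>M\<^esub> y" "h \<in> H i" unfolding gen by blast
      moreover from this(2) obtain v where "h = p v" using p by blast
      ultimately have "z = q (\<lambda>j. case j of 0 \<Rightarrow> a | Suc j \<Rightarrow> v j)" by (simp add: q_def)
      then show "z \<in> range q" by blast
    qed
    have "fin_gen_module R (M\<lparr>carrier := H (Suc i)\<rparr>)"
      unfolding fin_gen_module_def
    proof (intro conjI exI[of _ "insert y S"] allI impI)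
      fix K assume K: "submodule K R (M\<lparr>carrier := H (Suc i)\<rparr>) \<and> insert y S \<subseteq> K"
      then have "K \<subseteq> H (Suc i)" using module.submoduleE(1)[OF mod[OF Suc.prems]] by auto
      then show "K = carrier (M\<lparr>carrier := H (Suc i)\<rparr>)"
        using S' submodule_restrict[OF H[OF Suc.prems]] K by auto
    qed (use S less[OF i(1)] y mod[OF Suc.prems] in auto)
    then obtain X where X: "X \<in> mod_cat R" "module_iso R X (M\<lparr>carrier := H (Suc i)\<rparr>)"
      using mod_cat_representative[of R "M\<lparr>carrier := H (Suc i)\<rparr>" q] q by auto
    have "built_from R L (M\<lparr>carrier := H (Suc i)\<rparr>)"
      by (rule built_from_extension[OF bi built ex X R.quotient_module_module[OF I(1)]])
    moreover have "finite (insert y S)" "insert y S \<subseteq> H (Suc i)"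
      using S(1,2) y less[OF i(1)] by auto
    moreover have "\<forall>K. submodule K R M \<and> insert y S \<subseteq> K \<longrightarrow> H (Suc i) \<subseteq> K"
      using S' by blast
    ultimately show ?case using q by (intro exI conjI)
  qed
  from this[OF order_refl] show ?thesis by (elim exE conjE)
qed

end

lemma (in cring) built_from_finite_length:
  assumes I: "ideal I R" "I \<noteq> carrier R"
    and units: "\<And>r. r \<in> carrier R \<Longrightarrow> r \<notin> I \<Longrightarrow> r \<in> Units R"
    and built: "built_from R L (quotient_module R I)"
    and N: "finite_length R N"
  shows "built_from R L N"
proof -
  interpret N: module R N using N unfolding finite_length_def by (rule conjunct1)
  obtain l :: nat and H where H: "H 0 = {\<zero>\<^bsub>N\<^esub>}" "H l = carrier N" "\<forall>i\<le>l. submodule (H i) R N"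
    "\<forall>i<l. H i \<subset> H (Suc i) \<and>
      (\<forall>K. submodule K R N \<and> H i \<subseteq> K \<and> K \<subseteq> H (Suc i) \<longrightarrow> K = H i \<or> K = H (Suc i))"
    using N unfolding finite_length_def by (elim conjE exE)
  have "built_from R L (N\<lparr>carrier := H l\<rparr>)"
  proof (rule N.built_from_composition_series[of I L H l, OF I units built H(1)])
    show "submodule (H i) R N" if "i \<le> l" for i using H(3) that by blast
    show "H i \<subset> H (Suc i)" if "i < l" for i using H(4) that by blast
    show "K = H i \<or> K = H (Suc i)" if "i < l" "submodule K R N" "H i \<subseteq> K" "K \<subseteq> H (Suc i)" for i K
      using H(4) that by blast
  qed
  moreover have "module_iso R (N\<lparr>carrier := H l\<rparr>) N"
    unfolding module_iso_def using H(2)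
    by (intro bexI[of _ "\<lambda>x. x"]) (auto simp: bij_betw_def intro!: module_homI)
  ultimately show ?thesis by (rule built_from_iso)
qed

text \<open>Representatives of distinct residue classes: their differences lie outside
  \<open>I\<close>, which makes them units. These are the parameters on the curve.\<close>

lemma (in cring) infinite_residue_field_sequence:
  assumes I: "ideal I R" and inf: "infinite (carrier (R Quot I))"
    and units: "\<And>r. r \<in> carrier R \<Longrightarrow> r \<notin> I \<Longrightarrow> r \<in> Units R"
  obtains l :: "nat \<Rightarrow> 'a" where "\<And>i. l i \<in> carrier R" "\<And>i k. i \<noteq> k \<Longrightarrow> l i \<ominus> l k \<in> Units R"
proof -
  obtain f :: "nat \<Rightarrow> 'a set" where f: "inj f" "range f \<subseteq> carrier (R Quot I)"
    using infinite_countable_subset[OF inf] by blast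
  have "\<forall>i. \<exists>a\<in>carrier R. f i = I +> a"
    using f(2) by (auto simp: FactRing_def A_RCOSETS_def')
  then obtain l where l: "\<And>i. l i \<in> carrier R" "\<And>i. f i = I +> l i" by metis
  have "l i \<ominus> l k \<in> Units R" if "i \<noteq> k" for i k
  proof (rule units)
    have "f i \<noteq> f k" using that injD[OF f(1)] by blast
    then show "l i \<ominus> l k \<notin> I" using l rcos_eq_iff[OF I] by simp
  qed (use l(1) in simp)
  then show ?thesis using that l(1) by blast
qed

theorem theorem1p2:
  fixes R :: "('a, 'r) ring_scheme"
    and \<mm> :: "'a set"
    and n :: nat
    and N :: "('a, 'b, 'm) module_scheme"
  assumes "cring R"
    and "noetherian_ring R"
    and "local_ring R \<mm>"
    and "cohen_macaulay_local R \<mm>"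
    and "krull_dim R = 1"
    and "infinite (carrier (R Quot \<mm>))"
    and "depth (assoc_graded R \<mm>) (irrelevant_ideal R \<mm>) > 0"
    and "n > 0"
    and "finite_length R N"
  shows "built_from R (quotient_module R (ideal_power R \<mm> n)) N"
proof -
  interpret cring R by fact
  have max: "maximalideal \<mm> R" using assms(3) by (simp add: local_ring_def)
  then have I: "ideal \<mm> R" "\<mm> \<noteq> carrier R"
    using maximalideal.axioms(1) maximalideal.I_notcarr by blast+
  note pI = ideal_power_ideal[OF I(1)]
  note units = local_ring_Units[OF assms(2,3)]
  obtain l :: "nat \<Rightarrow> 'a" where l: "\<And>i. l i \<in> carrier R" "\<And>i k. i \<noteq> k \<Longrightarrow> l i \<ominus>\<^bsub>R\<^esub> l k \<in> Units R"
    using infinite_residue_field_sequence[OF I(1) assms(6) units] by metis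
  let ?M = "quotient_module R (ideal_power R \<mm> n)"
  have "built_from R ?M (quotient_module R (ideal_power R \<mm> j))" if "j \<le> n" for j
    using that
  proof (induction rule: inc_induct)
    case base
    then show ?case using built_from_self quotient_module_representative[OF pI] by blast
  next
    case (step j)
    \<comment> \<open>The induction descends from \<open>n\<close>, so the hypothesis concerns
      \<open>Suc j\<close>. The element \<open>x\<close> is chosen anew for each \<open>j\<close>;
      none serving all degrees at once is required.\<close>
    have "\<exists>x\<in>\<mm>. \<forall>w\<in>ideal_power R \<mm> j.
        x \<otimes>\<^bsub>R\<^esub> w \<in> ideal_power R \<mm> (Suc (Suc j)) \<longrightarrow> w \<in> ideal_power R \<mm> (Suc j)"
    proof (rule exists_superficial[OF assms(2) I(1), of l])
      show "w \<in> ideal_power R \<mm> (Suc k)" if "w \<in> ideal_power R \<mm> k"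
        "\<And>x. x \<in> \<mm> \<Longrightarrow> x \<otimes>\<^bsub>R\<^esub> w \<in> ideal_power R \<mm> (Suc (Suc k))" for k w
        using no_annihilator_of_depth[OF I(1) assms(7) that] .
    qed (fact l)+
    then obtain x where x: "x \<in> \<mm>" "\<And>w. w \<in> ideal_power R \<mm> j \<Longrightarrow>
        x \<otimes>\<^bsub>R\<^esub> w \<in> ideal_power R \<mm> (Suc (Suc j)) \<Longrightarrow> w \<in> ideal_power R \<mm> (Suc j)"
      by blast
    show ?case by (rule built_from_pred_power[OF assms(2) I(1) units x step.IH])
  qed
  \<comment> \<open>The descent stops at exponent 1, which is at most \<open>n\<close> because
    \<open>n\<close> is positive; there the quotient is the residue field.\<close>
  from this[of 1] have "built_from R ?M (quotient_module R \<mm>)"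
    using assms(8) ideal_power_1[OF I(1)] by simp
  then show ?thesis
    using units by (intro built_from_finite_length[OF I _ _ assms(9)])
qed

end
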